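(* Let $p = p(n)$ satisfy $p = \omega(1/n)$ and $p \le 1/2$, and let $B \sim \mathbb{B}(n,p)$. Let $H = H(B)$ be the bipartite graph with bi-adjacency matrix $B$, with $n$ left vertices $L$ and $n$ right vertices $R$. Then with probability $1-o(1)$ as $n\to\infty$, either (1) $\operatorname{corank}(B(H_{\mathrm{KS}})) = 0$, or (2) $\operatorname{corank}(B(H_{\mathrm{KS}})^\top) = 0$. It follows that with probability $1-o(1)$, $$\operatorname{corank}(B) = \max\left(|I_{\mathrm{KS}}\cap L|,\ |I_{\mathrm{KS}}\cap R|\right),$$ where $I_{\mathrm{KS}}$ is the set of isolated vertices remaining after the Karp-Sipser leaf-removal process on $H$.
   Context: $\mathbb{B}(n,p)$ is the distribution of the random matrix in $\{0,1\}^{n\times n}$ all of whose entries are independent Bernoulli($p$). For a bipartite graph $H$ with left vertices $L$ and right vertices $R$, $B(H)$ denotes its bi-adjacency matrix, with rows indexed by $L$ and columns by $R$; $H(B)$ is the bipartite graph with bi-adjacency matrix $B$. The corank of an $m\times n$ real matrix $M$ is $m-\operatorname{rank}(M)$ (rank over $\mathbb{R}$; the corank of an empty matrix is $0$). Karp-Sipser leaf-removal on a graph $H$: repeatedly, as long as there is a vertex of degree one, remove such a vertex together with its unique neighbor (and all incident edges). When no vertex of degree one remains, the remaining graph consists of isolated vertices, whose set is denoted $I_{\mathrm{KS}}$, and an induced subgraph of minimum degree at least two (possibly empty), denoted $H_{\mathrm{KS}}$; it retains the left/right partition inherited from $H$. *)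

theory Defs
  imports
    "HOL-Probability.Probability"
    "HOL-Probability.Product_PMF"
    "HOL-Library.Landau_Symbols"
    "Jordan_Normal_Form.DL_Rank"
    "Jordan_Normal_Form.DL_Missing_Sublist"
begin

record 'v ugraph =
  verts :: "'v set"
  edges :: "'v set set"

definition nbhd :: "'v ugraph \<Rightarrow> 'v \<Rightarrow> 'v set" where
  "nbhd G v = {u. {v, u} \<in> edges G}"

definition vdegree :: "'v ugraph \<Rightarrow> 'v \<Rightarrow> nat" where
  "vdegree G v = card (nbhd G v)"

definition delete_verts :: "'v ugraph \<Rightarrow> 'v set \<Rightarrow> 'v ugraph" where
  "delete_verts G W = \<lparr>verts = verts G - W, edges = {e \<in> edges G. e \<inter> W = {}}\<rparr>"

definition isolated_verts :: "'v ugraph \<Rightarrow> 'v set" where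
  "isolated_verts G = {v \<in> verts G. vdegree G v = 0}"

inductive leaf_removal :: "'v ugraph \<Rightarrow> 'v ugraph \<Rightarrow> bool" where
  "\<lbrakk>v \<in> verts G; vdegree G v = 1; {v, u} \<in> edges G\<rbrakk>
    \<Longrightarrow> leaf_removal G (delete_verts G {v, u})"

text \<open>The process leaves open which leaf is removed next, so its result is a relation:
  \<open>karp_sipser H G\<close> says that \<open>G\<close> is the remaining graph of some complete run on \<open>H\<close>.
  Then \<open>I_KS\<close> is \<open>isolated_verts G\<close> and \<open>H_KS\<close> is \<open>ks_core G\<close>.
  (The set \<open>I_KS\<close> does depend on the choices made: a path with three vertices leaves
  one of its two ends.)\<close>

definition karp_sipser :: "'v ugraph \<Rightarrow> 'v ugraph \<Rightarrow> bool" where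
  "karp_sipser H G \<longleftrightarrow> leaf_removal\<^sup>*\<^sup>* H G \<and> (\<forall>v \<in> verts G. vdegree G v \<noteq> 1)"

definition ks_core :: "'v ugraph \<Rightarrow> 'v ugraph" where
  "ks_core G = delete_verts G (isolated_verts G)"

text \<open>Bipartite graphs have vertices in \<open>nat + nat\<close>: \<open>Inl i\<close> is the left vertex of row \<open>i\<close>
  and \<open>Inr j\<close> the right vertex of column \<open>j\<close>.\<close>

definition bip_graph :: "real mat \<Rightarrow> (nat + nat) ugraph" where
  "bip_graph B =
    \<lparr>verts = Inl ` {..<dim_row B} \<union> Inr ` {..<dim_col B},
     edges = {{Inl i, Inr j} | i j. i < dim_row B \<and> j < dim_col B \<and> B $$ (i, j) = 1}\<rparr>"

text \<open>Rows and columns are indexed by the left and right vertices in increasing order;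
  \<open>pick S i\<close> is the \<open>i\<close>-th smallest element of \<open>S\<close>.\<close>

definition biadj :: "(nat + nat) ugraph \<Rightarrow> real mat" where
  "biadj G =
    (let L = {i. Inl i \<in> verts G}; R = {j. Inr j \<in> verts G}
     in mat (card L) (card R)
          (\<lambda>(i, j). of_bool ({Inl (pick L i), Inr (pick R j)} \<in> edges G)))"

text \<open>The subtraction does not truncate. The corank of the \<open>0 \<times> 0\<close> matrix is \<open>0\<close>; a graph of
  minimum degree at least two has left vertices iff it has right ones, so no other matrix
  without entries arises as its bi-adjacency matrix.\<close>

definition corank :: "real mat \<Rightarrow> nat" where
  "corank M = dim_row M - vec_space.rank (dim_row M) M"

definition bernoulli_mat :: "nat \<Rightarrow> real \<Rightarrow> real mat pmf" where
  "bernoulli_mat n p =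
    map_pmf (\<lambda>b. mat n n (\<lambda>ij. of_bool (b ij)))
      (Pi_pmf ({..<n} \<times> {..<n}) False (\<lambda>_. bernoulli_pmf p))"

text \<open>Sanity checks: a run exists on every finite graph, and \<open>biadj\<close> inverts \<open>bip_graph\<close> on
  matrices with entries in \<open>{0, 1}\<close>.\<close>

lemma karp_sipser_exists:
  assumes "finite (verts H)"
  shows "\<exists>G. karp_sipser H G"
  using assms
proof (induction "card (verts H)" arbitrary: H rule: less_induct)
  case less
  show ?case
  proof (cases "\<forall>v \<in> verts H. vdegree H v \<noteq> 1")
    case True
    then show ?thesis by (auto simp: karp_sipser_def)
  next
    case False
    then obtain v where v: "v \<in> verts H" "vdegree H v = 1" by auto
    then obtain u where "nbhd H v = {u}"
      by (auto simp: vdegree_def card_1_singleton_iff)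
    then have "{v, u} \<in> edges H" by (auto simp: nbhd_def)
    with v have step: "leaf_removal H (delete_verts H {v, u})"
      by (rule leaf_removal.intros)
    have "verts (delete_verts H {v, u}) \<subset> verts H"
      using v by (auto simp: delete_verts_def)
    with less.prems have "card (verts (delete_verts H {v, u})) < card (verts H)"
        "finite (verts (delete_verts H {v, u}))"
      by (auto intro: psubset_card_mono finite_subset)
    with less.hyps obtain G where "karp_sipser (delete_verts H {v, u}) G" by blast
    with step show ?thesis
      unfolding karp_sipser_def by (blast intro: converse_rtranclp_into_rtranclp)
  qed
qed

lemma pick_lessThan: "i < n \<Longrightarrow> pick {..<n} i = i"
proof (induction i)
  case 0
  then show ?case by (auto intro: Least_equality)
next
  case (Suc i)
  then show ?case by (auto intro!: Least_equality)
qed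

lemma biadj_bip_graph:
  assumes "\<And>i j. i < dim_row B \<Longrightarrow> j < dim_col B \<Longrightarrow> B $$ (i, j) \<in> {0, 1}"
  shows "biadj (bip_graph B) = B"
proof -
  have L: "{i. Inl i \<in> verts (bip_graph B)} = {..<dim_row B}"
    and R: "{j. Inr j \<in> verts (bip_graph B)} = {..<dim_col B}"
    by (auto simp: bip_graph_def)
  show ?thesis
    unfolding biadj_def Let_def L R
    using assms
    by (intro eq_matI) (fastforce simp: pick_lessThan bip_graph_def doubleton_eq_iff)+
qed

end

theory Submission
  imports Defs
begin

text \<open>
Everything follows from one claim: with high probability the core does not have a nonzero left and a
nonzero right null vector at the same time. Leaf removal changes the null spaces in a transparent way
(\<open>leaf_removal_adj_null\<close>): both null spaces of the matrix are those of the remaining graph, that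
is, those of the core plus one free coordinate for each isolated vertex. So if, say, the core has no
right null vector, then the corank of the matrix is the number of isolated columns
(\<open>corank_eq_isolated\<close>).

For the claim, extend a null vector of the core to one of the full matrix and shrink its support to
a circuit \<open>S\<close> that still meets the core. No row meets \<open>S\<close> exactly once, and at least \<open>card S - 1\<close> rows meet it.
Small circuits whose graph is a tree do exist in the sparse random matrix, but a tree cannot meet the
core (\<open>no_sparse_circuit_in_core\<close>); hence the graph of \<open>S\<close> has at least one edge more than a tree
(\<open>core_null_vector_surplus\<close>). Write \<open>d = n p\<close>, which tends to infinity, and distinguish the size of \<open>S\<close>.

\<^item> If \<open>card S \<le> 72/p\<close>, a first moment computation excludes such sets: the expected number of those
of size \<open>k\<close> is at most \<open>2 (C d\<^sup>2 exp (- c d))\<^sup>k\<close> (\<open>prob_sparse_surplus_le\<close>).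

\<^item> If \<open>72/p < card S \<le> n/36\<close>, a Littlewood-Offord inequality says that a random row is orthogonal to a
given vector with support \<open>S\<close> with probability at most \<open>1/2\<close>. Fewer than \<open>card S\<close> rows
determine a null vector with support \<open>S\<close>, and all the other rows have to be orthogonal to it, which
beats the number of choices (\<open>prob_medium_null_vector_le\<close>).

\<^item> Otherwise \<open>card S > n/36\<close>. By symmetry the left null vector also has support larger than \<open>n/36\<close>. Then a
positive proportion of the rows are combinations of the remaining rows, and each such row is orthogonal
to a right null vector of large support that depends on the remaining rows only; this has probability
\<open>O (1 / sqrt d)\<close> for each row (\<open>prob_large_null_vectors_le\<close>).

The last step needs null vectors on both sides, which is why only one of the two
coranks is shown to vanish. The Littlewood-Offord inequality for biased bits (\<open>littlewood_offord\<close>) is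
obtained by comparing the total influence of a monotone threshold event with the variance of the number
of ones.
\<close>

section \<open>Null vectors and rank\<close>

text \<open>A matrix is a function of its two indices, and a submatrix is obtained by restricting the index
sets \<open>I\<close> (rows) and \<open>J\<close> (columns). Left null vectors are null vectors of \<open>\<lambda>j i. A i j\<close>.\<close>

definition null_vector :: "'i set \<Rightarrow> 'j set \<Rightarrow> ('i \<Rightarrow> 'j \<Rightarrow> real) \<Rightarrow> ('j \<Rightarrow> real) \<Rightarrow> bool" where
  "null_vector I J A x \<longleftrightarrow> (\<forall>i\<in>I. (\<Sum>j\<in>J. A i j * x j) = 0)"

definition indep_columns :: "'i set \<Rightarrow> 'j set \<Rightarrow> ('i \<Rightarrow> 'j \<Rightarrow> real) \<Rightarrow> bool" where
  "indep_columns I T A \<longleftrightarrow> (\<forall>x. null_vector I T A x \<longrightarrow> (\<forall>t\<in>T. x t = 0))"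

definition spanning_columns :: "'i set \<Rightarrow> 'j set \<Rightarrow> 'j set \<Rightarrow> ('i \<Rightarrow> 'j \<Rightarrow> real) \<Rightarrow> bool" where
  "spanning_columns I J T A \<longleftrightarrow> (\<forall>j\<in>J. \<exists>c. \<forall>i\<in>I. A i j = (\<Sum>t\<in>T. A i t * c t))"

text \<open>Gaussian elimination, one row at a time. The resulting dimension count is used for rows
as well as for columns.\<close>

lemma underdetermined_null_vector:
  fixes A :: "'i \<Rightarrow> 'j \<Rightarrow> real"
  assumes "finite I" "finite J" "card I < card J"
  shows "\<exists>x. null_vector I J A x \<and> (\<exists>j\<in>J. x j \<noteq> 0) \<and> (\<forall>j. j \<notin> J \<longrightarrow> x j = 0)"
  using assms
proof (induction I arbitrary: J A rule: finite_induct)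
  case empty
  then obtain j where "j \<in> J" by (metis card_gt_0_iff card.empty ex_in_conv)
  then show ?case
    by (intro exI[of _ "\<lambda>k. if k = j then 1 else 0"]) (auto simp: null_vector_def)
next
  case (insert i I)
  show ?case
  proof (cases "\<forall>j\<in>J. A i j = 0")
    case True
    from insert.IH[of J A] insert.prems insert.hyps obtain x where
      "null_vector I J A x" "\<exists>j\<in>J. x j \<noteq> 0" "\<forall>j. j \<notin> J \<longrightarrow> x j = 0" by auto
    with True show ?thesis by (intro exI[of _ x]) (auto simp: null_vector_def)
  next
    case False
    then obtain j0 where j0: "j0 \<in> J" "A i j0 \<noteq> 0" by auto
    define J' where "J' = J - {j0}"
    have J: "J = insert j0 J'" "j0 \<notin> J'" "finite J'" using j0 insert.prems by (auto simp: J'_def)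
    define A' where "A' r j = A r j - A r j0 * (A i j / A i j0)" for r j
    have "card I < card J'" using insert.prems insert.hyps J by simp
    with insert.IH[of J' A'] J obtain x' where x':
      "null_vector I J' A' x'" "\<exists>j\<in>J'. x' j \<noteq> 0" "\<forall>j. j \<notin> J' \<longrightarrow> x' j = 0" by auto
    define c where "c = - (\<Sum>j\<in>J'. A i j * x' j) / A i j0"
    define x where "x = x'(j0 := c)"
    have sum_x: "(\<Sum>j\<in>J. A r j * x j) = A r j0 * c + (\<Sum>j\<in>J'. A r j * x' j)" for r
    proof -
      have "(\<Sum>j\<in>J'. A r j * x j) = (\<Sum>j\<in>J'. A r j * x' j)"
        using J by (intro sum.cong) (auto simp: x_def)
      then show ?thesis using J by (simp add: x_def)
    qed
    have "null_vector (insert i I) J A x"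
      unfolding null_vector_def
    proof
      fix r assume "r \<in> insert i I"
      show "(\<Sum>j\<in>J. A r j * x j) = 0"
      proof (cases "r = i")
        case True
        then show ?thesis unfolding sum_x using j0 by (simp add: c_def)
      next
        case False
        with \<open>r \<in> insert i I\<close> x'(1) have "(\<Sum>j\<in>J'. A' r j * x' j) = 0"
          by (simp add: null_vector_def)
        moreover have "(\<Sum>j\<in>J'. A' r j * x' j)
            = (\<Sum>j\<in>J'. A r j * x' j - A r j0 / A i j0 * (A i j * x' j))"
          by (intro sum.cong) (simp_all add: A'_def left_diff_distrib)
        ultimately have "(\<Sum>j\<in>J'. A r j * x' j) - A r j0 / A i j0 * (\<Sum>j\<in>J'. A i j * x' j) = 0"
          by (simp only: sum_subtractf sum_distrib_left[symmetric])
        then show ?thesis unfolding sum_x by (simp add: c_def)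
      qed
    qed
    moreover have "\<exists>j\<in>J. x j \<noteq> 0" using x'(2) J by (auto simp: x_def)
    moreover have "\<forall>j. j \<notin> J \<longrightarrow> x j = 0" using x'(3) J by (auto simp: x_def)
    ultimately show ?thesis by blast
  qed
qed

text \<open>A largest independent set of columns spans: a column outside its span could be added to it.\<close>

lemma column_basis_exists:
  fixes A :: "'i \<Rightarrow> 'j \<Rightarrow> real"
  assumes "finite J"
  shows "\<exists>T\<subseteq>J. indep_columns I T A \<and> spanning_columns I J T A"
proof -
  define P where "P T \<longleftrightarrow> T \<subseteq> J \<and> indep_columns I T A" for T
  have "P {}" by (auto simp: P_def indep_columns_def)
  moreover have "\<forall>T. P T \<longrightarrow> card T < Suc (card J)"
    using assms by (auto simp: P_def less_Suc_eq_le intro: card_mono)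
  ultimately have "\<exists>T. P T \<and> (\<forall>T'. P T' \<longrightarrow> card T' \<le> card T)"
    by (rule ex_has_greatest_nat)
  then obtain T where T: "P T" "\<And>T'. P T' \<Longrightarrow> card T' \<le> card T" by auto
  have fin: "finite T" using T(1) assms finite_subset by (auto simp: P_def)
  have "\<exists>c. \<forall>i\<in>I. A i j = (\<Sum>t\<in>T. A i t * c t)" if j: "j \<in> J" for j
  proof (rule ccontr)
    assume no: "\<not> ?thesis"
    have "j \<notin> T"
    proof
      assume "j \<in> T"
      then have "\<exists>c. \<forall>i\<in>I. A i j = (\<Sum>t\<in>T. A i t * c t)"
        using fin by (intro exI[of _ "\<lambda>t. if t = j then 1 else 0"]) (simp add: mult_delta_right)
      with no show False ..
    qed
    have "x t = 0" if x: "null_vector I (insert j T) A x" and "t \<in> insert j T" for x t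
    proof -
      have eq: "A i j * x j + (\<Sum>t\<in>T. A i t * x t) = 0" if "i \<in> I" for i
        using x that fin \<open>j \<notin> T\<close> by (auto simp: null_vector_def)
      have xj: "x j = 0"
      proof (rule ccontr)
        assume nz: "x j \<noteq> 0"
        have "A i j = (\<Sum>t\<in>T. A i t * (- x t / x j))" if "i \<in> I" for i
        proof -
          from eq[OF that] have "A i j * x j = - (\<Sum>t\<in>T. A i t * x t)" by linarith
          then have "A i j = - (\<Sum>t\<in>T. A i t * x t) / x j"
            using nz by (metis nonzero_mult_div_cancel_right)
          also have "\<dots> = (\<Sum>t\<in>T. A i t * (- x t / x j))"
            by (simp add: sum_divide_distrib sum_negf)
          finally show ?thesis .
        qed
        then have "\<exists>c. \<forall>i\<in>I. A i j = (\<Sum>t\<in>T. A i t * c t)"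
          by (intro exI[of _ "\<lambda>t. - x t / x j"]) simp
        with no show False ..
      qed
      with eq have "null_vector I T A x" by (auto simp: null_vector_def)
      with T(1) have "\<forall>t\<in>T. x t = 0" by (auto simp: P_def indep_columns_def)
      with xj that show ?thesis by auto
    qed
    then have "P (insert j T)" using T(1) j by (auto simp: P_def indep_columns_def)
    from T(2)[OF this] show False using fin \<open>j \<notin> T\<close> by simp
  qed
  with T(1) show ?thesis by (auto simp: P_def spanning_columns_def)
qed

lemma rank_eq_card_basis:
  assumes M: "M \<in> carrier_mat m r"
    and T: "T \<subseteq> {..<r}" "indep_columns {..<m} T (\<lambda>i j. M $$ (i, j))"
      "spanning_columns {..<m} {..<r} T (\<lambda>i j. M $$ (i, j))"
  shows "vec_space.rank m M = card T"
proof -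
  interpret V: vec_space "TYPE(real)" m .
  have fin: "finite T" using T(1) finite_subset by auto
  have col: "col M j \<in> carrier_vec m" "i < m \<Longrightarrow> vec_index (col M j) i = M $$ (i, j)" if "j < r" for i j
    using M that by auto
  define S where "S = col M ` T"
  have inj: "inj_on (col M) T"
  proof (rule inj_onI, rule ccontr)
    fix s t assume st: "s \<in> T" "t \<in> T" "col M s = col M t" "s \<noteq> t"
    define x where "x k = (if k = s then 1 else if k = t then -1 else 0 :: real)" for k
    have "null_vector {..<m} T (\<lambda>i j. M $$ (i, j)) x"
      unfolding null_vector_def
    proof
      fix i assume i: "i \<in> {..<m}"
      have "M $$ (i, s) = M $$ (i, t)"
        using col(2)[of s i] col(2)[of t i] st(3) subsetD[OF T(1) st(1)] subsetD[OF T(1) st(2)] i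
        by simp
      moreover have "(\<Sum>j\<in>T. M $$ (i, j) * x j)
          = (\<Sum>j\<in>T. (if j = s then M $$ (i, j) else 0) - (if j = t then M $$ (i, j) else 0))"
        using st(4) by (intro sum.cong) (auto simp: x_def)
      ultimately show "(\<Sum>j\<in>T. M $$ (i, j) * x j) = 0"
        using st fin by (simp add: sum_subtractf)
    qed
    with T(2) st(1) have "x s = 0" by (auto simp: indep_columns_def)
    then show False by (simp add: x_def)
  qed
  have carrier: "S \<subseteq> carrier_vec m" using T(1) col(1) by (auto simp: S_def)
  have finS: "finite S" using fin by (simp add: S_def)
  have lincomb: "vec_index (V.lincomb a S) i = (\<Sum>t\<in>T. M $$ (i, t) * a (col M t))" if "i < m" for a i
  proof -
    have "vec_index (V.lincomb a S) i = (\<Sum>v\<in>S. a v * vec_index v i)"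
      using V.lincomb_index[OF that carrier] .
    also have "\<dots> = (\<Sum>t\<in>T. a (col M t) * vec_index (col M t) i)"
      unfolding S_def using inj by (simp add: sum.reindex)
    also have "\<dots> = (\<Sum>t\<in>T. M $$ (i, t) * a (col M t))"
      using T(1) that col(2) by (intro sum.cong) auto
    finally show ?thesis .
  qed
  have indpt: "V.lin_indpt S"
  proof
    assume "V.lin_dep S"
    from V.finite_lin_dep[OF finS this carrier] obtain a v where
      a: "V.lincomb a S = 0\<^sub>v m" "v \<in> S" "a v \<noteq> 0" by auto
    then obtain t where t: "t \<in> T" "v = col M t" by (auto simp: S_def)
    have "null_vector {..<m} T (\<lambda>i j. M $$ (i, j)) (\<lambda>t. a (col M t))"
      unfolding null_vector_def using lincomb[of _ a] a(1) by auto
    with T(2) t a(3) show False by (auto simp: indep_columns_def)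
  qed
  have cols: "set (cols M) = col M ` {..<r}"
    using M by (auto simp: cols_def atLeast0LessThan)
  have "maximal S (\<lambda>T. T \<subseteq> set (cols M) \<and> V.lin_indpt T)"
    unfolding maximal_def
  proof (intro conjI allI impI)
    show "S \<subseteq> set (cols M)" using T(1) by (auto simp: cols S_def)
    show "V.lin_indpt S" by (rule indpt)
    fix S' assume S': "S \<subseteq> S' \<and> S' \<subseteq> set (cols M) \<and> V.lin_indpt S'"
    show "S' = S"
    proof (rule ccontr)
      assume "S' \<noteq> S"
      with S' obtain v where v: "v \<in> S'" "v \<notin> S" by auto
      with S' obtain j where j: "j < r" "v = col M j" by (auto simp: cols)
      from T(3) j obtain c where c: "\<forall>i\<in>{..<m}. M $$ (i, j) = (\<Sum>t\<in>T. M $$ (i, t) * c t)"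
        by (auto simp: spanning_columns_def)
      have "V.lincomb (\<lambda>w. c (the_inv_into T (col M) w)) S = v"
      proof (rule eq_vecI)
        show dim: "dim_vec (V.lincomb (\<lambda>w. c (the_inv_into T (col M) w)) S) = dim_vec v"
          using V.lincomb_dim[OF finS carrier] j M by simp
        fix i assume "i < dim_vec v"
        then have i: "i < m" using j M by simp
        show "vec_index (V.lincomb (\<lambda>w. c (the_inv_into T (col M) w)) S) i = vec_index v i"
          unfolding lincomb[OF i] using c i j M inj
          by (simp add: the_inv_into_f_f)
      qed
      then have "v \<in> V.span S" unfolding V.finite_span[OF finS carrier] by blast
      moreover have "v \<in> carrier_vec m" using j col by simp
      ultimately have "V.lin_dep (S \<union> {v})"
        using V.lin_dep_iff_in_span[OF carrier indpt _ v(2)] by simp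
      moreover have "S \<union> {v} \<subseteq> S'" using v S' by auto
      ultimately show False using S' V.supset_ld_is_ld by blast
    qed
  qed
  from V.rank_card_indpt[OF M this] have "V.rank M = card S" .
  then show ?thesis using inj by (simp add: S_def card_image)
qed

text \<open>The last two hypotheses say that restriction to \<open>J\<close> is a bijection from the null space onto
\<open>\<real>\<^sup>J\<close>, so the nullity is \<open>card J\<close>. Concretely, the columns outside \<open>J\<close> form a basis of the
column space.\<close>

lemma rank_eq_of_null_space_coordinates:
  assumes M: "M \<in> carrier_mat m r" and J: "J \<subseteq> {..<r}"
    and inj: "\<And>x. null_vector {..<m} {..<r} (\<lambda>i j. M $$ (i, j)) x \<Longrightarrow> \<forall>j\<in>J. x j = 0
      \<Longrightarrow> \<forall>j<r. x j = 0"
    and ext: "\<And>j. j \<in> J \<Longrightarrow> \<exists>x. null_vector {..<m} {..<r} (\<lambda>i j. M $$ (i, j)) x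
        \<and> (\<forall>k\<in>J. x k = of_bool (k = j))"
  shows "vec_space.rank m M = r - card J"
proof -
  define T where "T = {..<r} - J"
  have fin: "finite T" "finite J" using J finite_subset by (auto simp: T_def)
  have split: "(\<Sum>j<r. f j) = (\<Sum>j\<in>J. f j) + (\<Sum>j\<in>T. f j)" for f :: "nat \<Rightarrow> real"
    using sum.subset_diff[OF J, of f] by (simp add: T_def)
  have "vec_space.rank m M = card T"
  proof (rule rank_eq_card_basis[OF M])
    show "T \<subseteq> {..<r}" by (auto simp: T_def)
    show "indep_columns {..<m} T (\<lambda>i j. M $$ (i, j))"
      unfolding indep_columns_def
    proof (intro allI impI ballI)
      fix x t assume x: "null_vector {..<m} T (\<lambda>i j. M $$ (i, j)) x" and t: "t \<in> T"
      define x' where "x' j = (if j \<in> T then x j else 0)" for j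
      have "\<forall>j\<in>J. x' j = 0" by (auto simp: x'_def T_def)
      moreover have "null_vector {..<m} {..<r} (\<lambda>i j. M $$ (i, j)) x'"
        using x calculation by (simp add: null_vector_def split x'_def cong: sum.cong)
      ultimately have "x' t = 0" using inj[of x'] t by (auto simp: T_def)
      then show "x t = 0" using t by (simp add: x'_def)
    qed
    show "spanning_columns {..<m} {..<r} T (\<lambda>i j. M $$ (i, j))"
      unfolding spanning_columns_def
    proof
      fix j assume j: "j \<in> {..<r}"
      show "\<exists>c. \<forall>i\<in>{..<m}. M $$ (i, j) = (\<Sum>t\<in>T. M $$ (i, t) * c t)"
      proof (cases "j \<in> J")
        case True
        from ext[OF this] obtain x where x: "null_vector {..<m} {..<r} (\<lambda>i j. M $$ (i, j)) x"
          "\<forall>k\<in>J. x k = of_bool (k = j)" by auto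
        have "M $$ (i, j) = (\<Sum>t\<in>T. M $$ (i, t) * (- x t))" if "i < m" for i
        proof -
          have "(\<Sum>k\<in>J. M $$ (i, k) * x k) = (\<Sum>k\<in>J. if k = j then M $$ (i, k) else 0)"
            using x(2) by (intro sum.cong) auto
          also have "\<dots> = M $$ (i, j)" using True fin by simp
          finally have "(\<Sum>k\<in>J. M $$ (i, k) * x k) = M $$ (i, j)" .
          moreover have "(\<Sum>k\<in>J. M $$ (i, k) * x k) + (\<Sum>t\<in>T. M $$ (i, t) * x t) = 0"
            using x(1) that by (simp add: null_vector_def split)
          ultimately show ?thesis by (simp add: sum_negf)
        qed
        then show ?thesis by (intro exI[of _ "\<lambda>t. - x t"]) simp
      next
        case False
        then have "j \<in> T" using j by (simp add: T_def)
        then show ?thesis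
          using fin by (intro exI[of _ "\<lambda>t. if t = j then 1 else 0"]) (simp add: mult_delta_right)
      qed
    qed
  qed
  then show ?thesis using J fin by (simp add: T_def card_Diff_subset)
qed

text \<open>The same for the left null space, although the rank is a column rank. A column basis has at
most \<open>m - card J\<close> elements because the rows outside \<open>J\<close> span the row space, and at
least as many because otherwise a left null vector of the basis columns, and hence of all columns,
would vanish on \<open>J\<close>.\<close>

lemma rank_eq_of_left_null_space_coordinates:
  assumes M: "M \<in> carrier_mat m r" and J: "J \<subseteq> {..<m}"
    and inj: "\<And>y. null_vector {..<r} {..<m} (\<lambda>j i. M $$ (i, j)) y \<Longrightarrow> \<forall>i\<in>J. y i = 0
      \<Longrightarrow> \<forall>i<m. y i = 0"
    and ext: "\<And>i. i \<in> J \<Longrightarrow> \<exists>y. null_vector {..<r} {..<m} (\<lambda>j i. M $$ (i, j)) y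
        \<and> (\<forall>k\<in>J. y k = of_bool (k = i))"
  shows "vec_space.rank m M = m - card J"
proof -
  define I where "I = {..<m} - J"
  have fin: "finite I" "finite J" using J finite_subset by (auto simp: I_def)
  have cardI: "card I = m - card J" using J fin by (simp add: I_def card_Diff_subset)
  have split: "(\<Sum>j<m. f j) = (\<Sum>j\<in>J. f j) + (\<Sum>j\<in>I. f j)" for f :: "nat \<Rightarrow> real"
    using sum.subset_diff[OF J, of f] by (simp add: I_def)
  obtain T where T: "T \<subseteq> {..<r}" "indep_columns {..<m} T (\<lambda>i j. M $$ (i, j))"
      "spanning_columns {..<m} {..<r} T (\<lambda>i j. M $$ (i, j))"
    using column_basis_exists[of "{..<r}" "{..<m}" "\<lambda>i j. M $$ (i, j)"] by auto
  have finT: "finite T" using T(1) finite_subset by auto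
  have swap: "(\<Sum>i<m. y i * (\<Sum>t\<in>T. M $$ (i, t) * x t))
      = (\<Sum>t\<in>T. x t * (\<Sum>i<m. M $$ (i, t) * y i))" for x y
    unfolding sum_distrib_left by (subst sum.swap) (simp add: algebra_simps)
  \<comment> \<open>A null vector of the rows outside \<open>J\<close> is one of all rows: pairing with the left null
    vector that restricts to the unit vector at \<open>i\<close> extracts row \<open>i\<close>.\<close>
  have "\<not> card T > card I"
  proof
    assume "card T > card I"
    from underdetermined_null_vector[OF fin(1) finT this, of "\<lambda>i j. M $$ (i, j)"] obtain x t
      where x: "null_vector I T (\<lambda>i j. M $$ (i, j)) x" "t \<in> T" "x t \<noteq> 0" by auto
    have "null_vector {..<m} T (\<lambda>i j. M $$ (i, j)) x"
      unfolding null_vector_def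
    proof
      fix i assume i: "i \<in> {..<m}"
      show "(\<Sum>j\<in>T. M $$ (i, j) * x j) = 0"
      proof (cases "i \<in> J")
        case True
        from ext[OF this] obtain y where y: "null_vector {..<r} {..<m} (\<lambda>j i. M $$ (i, j)) y"
          "\<forall>k\<in>J. y k = of_bool (k = i)" by auto
        have "0 = (\<Sum>k<m. y k * (\<Sum>t\<in>T. M $$ (k, t) * x t))"
          unfolding swap using y(1) T(1) by (auto simp: null_vector_def intro!: sum.neutral)
        also have "\<dots> = (\<Sum>k\<in>J. y k * (\<Sum>t\<in>T. M $$ (k, t) * x t))"
          unfolding split using x(1) by (simp add: null_vector_def)
        also have "\<dots> = (\<Sum>k\<in>J. if k = i then (\<Sum>t\<in>T. M $$ (k, t) * x t) else 0)"
          using y(2) by (intro sum.cong) auto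
        also have "\<dots> = (\<Sum>t\<in>T. M $$ (i, t) * x t)" using True fin by simp
        finally show ?thesis by simp
      next
        case False
        then show ?thesis using i x(1) by (auto simp: null_vector_def I_def)
      qed
    qed
    with T(2) x show False by (auto simp: indep_columns_def)
  qed
  moreover have "\<not> card T < card I"
  proof
    assume "card T < card I"
    from underdetermined_null_vector[OF finT fin(1) this, of "\<lambda>j i. M $$ (i, j)"] obtain y i
      where y: "null_vector T I (\<lambda>j i. M $$ (i, j)) y" "i \<in> I" "y i \<noteq> 0" "\<forall>i. i \<notin> I \<longrightarrow> y i = 0"
      by auto
    have yT: "(\<Sum>i<m. M $$ (i, t) * y i) = 0" if "t \<in> T" for t
      unfolding split using y(1,4) that by (auto simp: null_vector_def I_def)
    have "null_vector {..<r} {..<m} (\<lambda>j i. M $$ (i, j)) y"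
      unfolding null_vector_def
    proof
      fix j assume j: "j \<in> {..<r}"
      with T(3) obtain c where c: "\<forall>i\<in>{..<m}. M $$ (i, j) = (\<Sum>t\<in>T. M $$ (i, t) * c t)"
        by (auto simp: spanning_columns_def)
      have "(\<Sum>i<m. M $$ (i, j) * y i) = (\<Sum>i<m. y i * (\<Sum>t\<in>T. M $$ (i, t) * c t))"
        using c by (intro sum.cong) auto
      also have "\<dots> = 0" unfolding swap using yT by simp
      finally show "(\<Sum>i<m. M $$ (i, j) * y i) = 0" .
    qed
    moreover have "\<forall>i\<in>J. y i = 0" using y(4) by (auto simp: I_def)
    ultimately have "\<forall>i<m. y i = 0" by (rule inj)
    with y show False by (auto simp: I_def)
  qed
  ultimately have "card T = m - card J" using cardI by simp
  then show ?thesis using rank_eq_card_basis[OF M T] by simp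
qed

section \<open>Leaf removal and the kernel of the adjacency matrix\<close>

definition wf_graph :: "'v ugraph \<Rightarrow> bool" where
  "wf_graph G \<longleftrightarrow> finite (verts G) \<and>
    (\<forall>e\<in>edges G. \<exists>u\<in>verts G. \<exists>v\<in>verts G. u \<noteq> v \<and> e = {u, v})"

text \<open>The kernel of the adjacency matrix of \<open>G\<close>. For a bipartite graph it is the direct sum of the
left and the right null space of the bi-adjacency matrix, and for leaf removal there is no
difference between the sides, so both null spaces are followed at once.\<close>

definition adj_null :: "'v ugraph \<Rightarrow> ('v \<Rightarrow> real) \<Rightarrow> bool" where
  "adj_null G w \<longleftrightarrow> (\<forall>v\<in>verts G. (\<Sum>u\<in>nbhd G v. w u) = 0)"

lemma wf_graph_nbhd:
  assumes "wf_graph G" "u \<in> nbhd G v"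
  shows "u \<in> verts G" "v \<in> verts G" "u \<noteq> v" "v \<in> nbhd G u"
  using assms by (fastforce simp: wf_graph_def nbhd_def doubleton_eq_iff insert_commute)+

lemma finite_nbhd: "wf_graph G \<Longrightarrow> finite (nbhd G v)"
  by (rule finite_subset[of _ "verts G"]) (use wf_graph_nbhd(1)[of G] in blast, simp add: wf_graph_def)

lemma wf_graph_delete_verts: "wf_graph G \<Longrightarrow> wf_graph (delete_verts G W)"
  by (fastforce simp: wf_graph_def delete_verts_def)

lemma nbhd_delete_verts: "v \<notin> W \<Longrightarrow> nbhd (delete_verts G W) v = nbhd G v - W"
  by (auto simp: nbhd_def delete_verts_def)

text \<open>Let the leaf \<open>v\<close> with neighbour \<open>u\<close> be removed. The equation at \<open>v\<close> says that the weight of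
\<open>u\<close> is zero, so the equations at the surviving vertices do not notice the removal. The
equation at \<open>u\<close> then expresses the weight of \<open>v\<close>, which enters no other equation, by the weights of
the other neighbours of \<open>u\<close>. Hence restriction to the remaining graph is a bijection of the kernels.\<close>

lemma leaf_removal_adj_null:
  assumes "leaf_removal G G'" and wf: "wf_graph G"
  shows "wf_graph G'"
    and "verts G' \<subseteq> verts G"
    and "edges G' = {e \<in> edges G. e \<subseteq> verts G'}"
    and "adj_null G w \<Longrightarrow> adj_null G' w"
    and "adj_null G' w \<Longrightarrow> \<exists>w'. adj_null G w' \<and> (\<forall>v\<in>verts G'. w' v = w v)"
    and "adj_null G w \<Longrightarrow> \<forall>v\<in>verts G'. w v = 0 \<Longrightarrow> \<forall>v\<in>verts G. w v = 0"
proof -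
  from assms(1) obtain v u where v: "v \<in> verts G" "vdegree G v = 1" "{v, u} \<in> edges G"
    and G': "G' = delete_verts G {v, u}"
    by (auto elim: leaf_removal.cases)
  have Nv: "nbhd G v = {u}"
  proof -
    have "u \<in> nbhd G v" using v(3) by (simp add: nbhd_def)
    then show ?thesis using v(2) by (auto simp: vdegree_def card_1_singleton_iff)
  qed
  have u: "u \<in> verts G" "u \<noteq> v" "v \<in> nbhd G u"
    using wf_graph_nbhd[OF wf, of u v] Nv by auto
  have fin: "finite (nbhd G x)" for x using finite_nbhd[OF wf] .
  have verts': "verts G' = verts G - {v, u}" by (simp add: G' delete_verts_def)
  have nbhd': "nbhd G' x = nbhd G x - {u}" and v_notin: "v \<notin> nbhd G x" if "x \<in> verts G'" for x
  proof -
    show *: "v \<notin> nbhd G x"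
      using wf_graph_nbhd(4)[OF wf, of v x] Nv that verts' by auto
    have "nbhd G' x = nbhd G x - {v, u}"
      unfolding G' using that verts' by (intro nbhd_delete_verts) auto
    with * show "nbhd G' x = nbhd G x - {u}" by auto
  qed
  have nbhd_u: "nbhd G u - {v} \<subseteq> verts G'"
    using wf_graph_nbhd[OF wf, of _ u] verts' by auto
  have sum': "(\<Sum>y\<in>nbhd G x. z y) = (\<Sum>y\<in>nbhd G' x. z y)"
    if "x \<in> verts G'" "z u = 0" for x and z :: "'a \<Rightarrow> real"
    unfolding nbhd'[OF that(1)] using fin that(2)
    by (intro sum.mono_neutral_right) auto
  have sum_u: "(\<Sum>y\<in>nbhd G u. z y) = z v + (\<Sum>y\<in>nbhd G u - {v}. z y)" for z :: "'a \<Rightarrow> real"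
    using fin u by (simp add: sum.remove)
  show "wf_graph G'" unfolding G' by (rule wf_graph_delete_verts[OF wf])
  show "verts G' \<subseteq> verts G" using verts' by auto
  show "edges G' = {e \<in> edges G. e \<subseteq> verts G'}"
    using wf by (fastforce simp: G' delete_verts_def wf_graph_def)
  have wu: "z u = 0" if "adj_null G z" for z
    using that v(1) Nv by (auto simp: adj_null_def)
  show "adj_null G' w" if "adj_null G w"
    unfolding adj_null_def using that sum'[of _ w] wu[OF that] verts' by (auto simp: adj_null_def)
  show "\<exists>w'. adj_null G w' \<and> (\<forall>v\<in>verts G'. w' v = w v)" if w: "adj_null G' w"
  proof -
    define w' where "w' = w(u := 0, v := - (\<Sum>y\<in>nbhd G u - {v}. w y))"
    have agree: "w' y = w y" if "y \<in> verts G'" for y using that verts' by (auto simp: w'_def)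
    have "(\<Sum>y\<in>nbhd G x. w' y) = 0" if x: "x \<in> verts G" for x
    proof -
      consider "x = v" | "x = u" | "x \<in> verts G'" using x verts' by auto
      then show ?thesis
      proof cases
        case 1
        then show ?thesis using Nv u by (simp add: w'_def)
      next
        case 2
        have "(\<Sum>y\<in>nbhd G u - {v}. w' y) = (\<Sum>y\<in>nbhd G u - {v}. w y)"
          using nbhd_u agree by (intro sum.cong) auto
        with 2 show ?thesis unfolding 2 sum_u by (simp add: w'_def)
      next
        case 3
        have "(\<Sum>y\<in>nbhd G x. w' y) = (\<Sum>y\<in>nbhd G' x. w' y)"
          using 3 u by (intro sum') (auto simp: w'_def)
        also have "\<dots> = (\<Sum>y\<in>nbhd G' x. w y)"
          using agree wf_graph_nbhd(1)[OF \<open>wf_graph G'\<close>] by (intro sum.cong) auto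
        finally show ?thesis using w 3 by (simp add: adj_null_def)
      qed
    qed
    then have "adj_null G w'" by (simp add: adj_null_def)
    with agree show ?thesis by blast
  qed
  show "\<forall>v\<in>verts G. w v = 0" if w: "adj_null G w" "\<forall>v\<in>verts G'. w v = 0"
  proof -
    have "(\<Sum>y\<in>nbhd G u - {v}. w y) = 0"
      using w(2) nbhd_u by (intro sum.neutral) auto
    moreover have "(\<Sum>y\<in>nbhd G u. w y) = 0" using w(1) u(1) by (simp add: adj_null_def)
    ultimately have "w v = 0" unfolding sum_u by simp
    with w(2) wu[OF w(1)] verts' show ?thesis by auto
  qed
qed

lemma leaf_removals_adj_null:
  assumes "leaf_removal\<^sup>*\<^sup>* H G" and wf: "wf_graph H"
  shows "wf_graph G"
    and "verts G \<subseteq> verts H"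
    and "edges G = {e \<in> edges H. e \<subseteq> verts G}"
    and "adj_null H w \<Longrightarrow> adj_null G w"
    and "adj_null G w \<Longrightarrow> \<exists>w'. adj_null H w' \<and> (\<forall>v\<in>verts G. w' v = w v)"
    and "adj_null H w \<Longrightarrow> \<forall>v\<in>verts G. w v = 0 \<Longrightarrow> \<forall>v\<in>verts H. w v = 0"
proof -
  have "wf_graph G \<and> verts G \<subseteq> verts H \<and> edges G = {e \<in> edges H. e \<subseteq> verts G} \<and>
    (\<forall>w. adj_null H w \<longrightarrow> adj_null G w) \<and>
    (\<forall>w. adj_null G w \<longrightarrow> (\<exists>w'. adj_null H w' \<and> (\<forall>v\<in>verts G. w' v = w v))) \<and>
    (\<forall>w. adj_null H w \<longrightarrow> (\<forall>v\<in>verts G. w v = 0) \<longrightarrow> (\<forall>v\<in>verts H. w v = 0))"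
    using assms(1)
  proof (induction rule: rtranclp_induct)
    case base
    have "edges H = {e \<in> edges H. e \<subseteq> verts H}" using wf by (fastforce simp: wf_graph_def)
    with wf show ?case by blast
  next
    case (step G G')
    then have wfG: "wf_graph G" by blast
    note leaf = leaf_removal_adj_null[OF step.hyps(2) wfG]
    have sub: "verts G \<subseteq> verts H" and edges: "edges G = {e \<in> edges H. e \<subseteq> verts G}"
      using step.IH by blast+
    have restrict: "adj_null G w" if "adj_null H w" for w using step.IH that by blast
    have extend: "\<exists>w'. adj_null H w' \<and> (\<forall>v\<in>verts G. w' v = w v)" if "adj_null G w" for w
      using step.IH that by blast
    have determined: "\<forall>v\<in>verts H. w v = 0" if "adj_null H w" "\<forall>v\<in>verts G. w v = 0" for w
      using step.IH that by blast
    show ?case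
    proof (intro conjI allI impI)
      show "wf_graph G'" by (rule leaf(1))
      show "verts G' \<subseteq> verts H" using leaf(2) sub by blast
      show "edges G' = {e \<in> edges H. e \<subseteq> verts G'}" unfolding leaf(3) edges using leaf(2) by auto
      show "adj_null G' w" if "adj_null H w" for w using leaf(4)[OF restrict[OF that]] .
      show "\<exists>w'. adj_null H w' \<and> (\<forall>v\<in>verts G'. w' v = w v)" if "adj_null G' w" for w
      proof -
        from leaf(5)[OF that] obtain w1 where "adj_null G w1" "\<forall>v\<in>verts G'. w1 v = w v" by auto
        moreover from extend[OF this(1)] obtain w2
          where "adj_null H w2" "\<forall>v\<in>verts G. w2 v = w1 v" by auto
        ultimately show ?thesis using leaf(2) by (intro exI[of _ w2]) auto
      qed
      show "\<forall>v\<in>verts H. w v = 0" if "adj_null H w" "\<forall>v\<in>verts G'. w v = 0" for w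
        using determined[OF that(1) leaf(6)[OF restrict[OF that(1)] that(2)]] .
    qed
  qed
  then show "wf_graph G"
    and "verts G \<subseteq> verts H"
    and "edges G = {e \<in> edges H. e \<subseteq> verts G}"
    and "adj_null H w \<Longrightarrow> adj_null G w"
    and "adj_null G w \<Longrightarrow> \<exists>w'. adj_null H w' \<and> (\<forall>v\<in>verts G. w' v = w v)"
    and "adj_null H w \<Longrightarrow> \<forall>v\<in>verts G. w v = 0 \<Longrightarrow> \<forall>v\<in>verts H. w v = 0"
    by blast+
qed

definition bipartite :: "(nat + nat) ugraph \<Rightarrow> bool" where
  "bipartite G \<longleftrightarrow> wf_graph G \<and> (\<forall>e\<in>edges G. \<exists>i j. e = {Inl i, Inr j})"

definition left :: "(nat + nat) set \<Rightarrow> nat set" where "left V = {i. Inl i \<in> V}"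
definition right :: "(nat + nat) set \<Rightarrow> nat set" where "right V = {j. Inr j \<in> V}"

lemma finite_left_right: "finite V \<Longrightarrow> finite (left V)" "finite V \<Longrightarrow> finite (right V)"
  unfolding left_def right_def
  using finite_vimageI[of V Inl] finite_vimageI[of V Inr] by (auto simp: vimage_def)

text \<open>Every step removes one vertex on each side.\<close>

lemma leaf_removals_balanced:
  assumes "leaf_removal\<^sup>*\<^sup>* H G" and bip: "bipartite H"
  shows "card (left (verts G)) + card (right (verts H)) = card (left (verts H)) + card (right (verts G))"
  using assms(1)
proof (induction rule: rtranclp_induct)
  case (step G G')
  have wfH: "wf_graph H" using bip by (simp add: bipartite_def)
  note inv = leaf_removals_adj_null[OF step.hyps(1) wfH]
  from step.hyps(2) obtain v u where v: "v \<in> verts G" "{v, u} \<in> edges G"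
    and G': "G' = delete_verts G {v, u}"
    by (auto elim: leaf_removal.cases)
  from v(2) inv(3) bip obtain i j where ij: "{v, u} = {Inl i, Inr j}" by (auto simp: bipartite_def)
  have mem: "Inl i \<in> verts G" "Inr j \<in> verts G" using v(2) inv(3) ij by auto
  have "left (verts G') = left (verts G) - {i}" "right (verts G') = right (verts G) - {j}"
    unfolding G' delete_verts_def ij by (auto simp: left_def right_def)
  moreover have "i \<in> left (verts G)" "j \<in> right (verts G)" using mem by (auto simp: left_def right_def)
  moreover have "finite (left (verts G))" "finite (right (verts G))"
    using inv(1) finite_left_right by (auto simp: wf_graph_def)
  ultimately have "card (left (verts G)) = Suc (card (left (verts G')))"
    "card (right (verts G)) = Suc (card (right (verts G')))"
    by (metis card_Suc_Diff1)+
  with step.IH show ?case by simp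
qed simp

text \<open>What a run of leaf removal does to the column side of a matrix: \<open>L\<close> and \<open>R\<close> are the rows and
columns of the core and \<open>Z\<close> the isolated columns. Null vectors of the full matrix correspond
to null vectors of the core together with arbitrary values on \<open>Z\<close>. The row side is
described by the same predicate for the transposed matrix.\<close>

definition core_reduction ::
  "nat \<Rightarrow> (nat \<Rightarrow> nat \<Rightarrow> real) \<Rightarrow> nat set \<Rightarrow> nat set \<Rightarrow> nat set \<Rightarrow> bool" where
  "core_reduction n A L R Z \<longleftrightarrow>
     L \<subseteq> {..<n} \<and> R \<subseteq> {..<n} \<and> Z \<subseteq> {..<n} \<and> R \<inter> Z = {} \<and>
     (\<forall>x. null_vector {..<n} {..<n} A x \<longrightarrow> null_vector L R A x) \<and>
     (\<forall>x. null_vector L R A x \<longrightarrow>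
        (\<exists>x'. null_vector {..<n} {..<n} A x' \<and> (\<forall>j\<in>R \<union> Z. x' j = x j))) \<and>
     (\<forall>x. null_vector {..<n} {..<n} A x \<longrightarrow> (\<forall>j\<in>R \<union> Z. x j = 0) \<longrightarrow> (\<forall>j<n. x j = 0)) \<and>
     (\<forall>j\<in>R. 2 \<le> card {i\<in>L. A i j \<noteq> 0})"

definition bool_mat :: "nat \<Rightarrow> (nat \<Rightarrow> nat \<Rightarrow> bool) \<Rightarrow> real mat" where
  "bool_mat n b = mat n n (\<lambda>(i, j). of_bool (b i j))"

lemma bip_graph_bool_mat:
  "verts (bip_graph (bool_mat n b)) = Inl ` {..<n} \<union> Inr ` {..<n}"
  "edges (bip_graph (bool_mat n b)) = {{Inl i, Inr j} | i j. i < n \<and> j < n \<and> b i j}"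
proof -
  have "bool_mat n b $$ (i, j) = 1 \<longleftrightarrow> b i j" if "i < n" "j < n" for i j
    using that by (simp add: bool_mat_def)
  then show "edges (bip_graph (bool_mat n b)) = {{Inl i, Inr j} | i j. i < n \<and> j < n \<and> b i j}"
    by (simp add: bip_graph_def bool_mat_def cong: conj_cong)
qed (simp add: bip_graph_def bool_mat_def)

lemma bipartite_bool_mat: "bipartite (bip_graph (bool_mat n b))"
  unfolding bipartite_def wf_graph_def bip_graph_bool_mat by fastforce

definition core :: "(nat + nat) ugraph \<Rightarrow> (nat + nat) set" where
  "core G = verts G - isolated_verts G"

text \<open>In the final graph the equations at isolated vertices are empty and the others involve core
vertices only, so its kernel splits into the two null spaces of the core and free isolated
coordinates.\<close>

lemma
  assumes ks: "karp_sipser (bip_graph (bool_mat n b)) G"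
  shows karp_sipser_core_reduction:
      "core_reduction n (\<lambda>i j. of_bool (b i j)) (left (core G)) (right (core G))
         (right (isolated_verts G))"
    and karp_sipser_core_reduction_transpose:
      "core_reduction n (\<lambda>j i. of_bool (b i j)) (right (core G)) (left (core G))
         (left (isolated_verts G))"
    and karp_sipser_balanced:
      "card (left (core G)) + card (left (isolated_verts G))
         = card (right (core G)) + card (right (isolated_verts G))"
    and karp_sipser_biadj:
      "biadj (ks_core G) = mat (card (left (core G))) (card (right (core G)))
         (\<lambda>(i, j). of_bool (b (pick (left (core G)) i) (pick (right (core G)) j)))"
proof -
  define H where "H = bip_graph (bool_mat n b)"
  have run: "leaf_removal\<^sup>*\<^sup>* H G" and deg: "\<forall>v\<in>verts G. vdegree G v \<noteq> 1"
    using ks by (auto simp: karp_sipser_def H_def)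
  have bip: "bipartite H" unfolding H_def by (rule bipartite_bool_mat)
  then have wfH: "wf_graph H" by (simp add: bipartite_def)
  note inv = leaf_removals_adj_null[OF run wfH]
  have vertsH: "verts H = Inl ` {..<n} \<union> Inr ` {..<n}" by (simp add: H_def bip_graph_bool_mat)
  have edgeH: "{Inl i, Inr j} \<in> edges H \<longleftrightarrow> i < n \<and> j < n \<and> b i j" for i j
    by (auto simp: H_def bip_graph_bool_mat doubleton_eq_iff)
  have no_edge: "{Inl i, Inl i'} \<notin> edges H" "{Inr i, Inr i'} \<notin> edges H" for i i' :: nat
    by (auto simp: H_def bip_graph_bool_mat doubleton_eq_iff)
  have sub: "verts G \<subseteq> verts H" by (rule inv(2))
  have edgeG: "{Inl i, Inr j} \<in> edges G \<longleftrightarrow> Inl i \<in> verts G \<and> Inr j \<in> verts G \<and> b i j" for i j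
    using inv(3) sub vertsH by (auto simp: edgeH)
  have finG: "finite (verts G)" using inv(1) by (simp add: wf_graph_def)
  have isolated: "v \<in> isolated_verts G \<longleftrightarrow> v \<in> verts G \<and> nbhd G v = {}" for v
    using finite_nbhd[OF inv(1)] by (auto simp: isolated_verts_def vdegree_def)
  have nbhd_core: "u \<in> core G" if "u \<in> nbhd G v" for u v
    using wf_graph_nbhd[OF inv(1) that] by (auto simp: core_def isolated)
  let ?L = "left (core G)" and ?R = "right (core G)"
  have finLR: "finite ?L" "finite ?R" using finG finite_left_right by (auto simp: core_def)
  have nbhd_left: "nbhd G (Inl i) = Inr ` {j\<in>?R. b i j}" if "i \<in> ?L" for i
  proof (intro equalityI subsetI)
    fix u :: "nat + nat" assume u: "u \<in> nbhd G (Inl i)"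
    obtain j where j: "u = Inr j"
      using u inv(3) no_edge by (cases u) (auto simp: nbhd_def)
    with u nbhd_core[OF u] show "u \<in> Inr ` {j\<in>?R. b i j}"
      by (auto simp: right_def nbhd_def edgeG)
  next
    fix u :: "nat + nat" assume "u \<in> Inr ` {j\<in>?R. b i j}"
    with that show "u \<in> nbhd G (Inl i)"
      by (auto simp: nbhd_def edgeG left_def right_def core_def)
  qed
  have nbhd_right: "nbhd G (Inr j) = Inl ` {i\<in>?L. b i j}" if "j \<in> ?R" for j
  proof (intro equalityI subsetI)
    fix u :: "nat + nat" assume u: "u \<in> nbhd G (Inr j)"
    obtain i where i: "u = Inl i"
      using u inv(3) no_edge by (cases u) (auto simp: nbhd_def)
    with u nbhd_core[OF u] show "u \<in> Inl ` {i\<in>?L. b i j}"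
      by (auto simp: left_def nbhd_def edgeG insert_commute)
  next
    fix u :: "nat + nat" assume "u \<in> Inl ` {i\<in>?L. b i j}"
    with that show "u \<in> nbhd G (Inr j)"
      by (auto simp: nbhd_def edgeG left_def right_def core_def insert_commute)
  qed
  have ofb: "(\<Sum>j\<in>S. of_bool (Q j) * f j) = (\<Sum>j\<in>{j\<in>S. Q j}. f j)"
    if "finite S" for S Q and f :: "nat \<Rightarrow> real"
    using that by (simp add: sum.inter_filter of_bool_def if_distrib[of "\<lambda>c. c * _"] cong: if_cong)
  have nullG: "adj_null G w \<longleftrightarrow> null_vector ?L ?R (\<lambda>i j. of_bool (b i j)) (\<lambda>j. w (Inr j))
      \<and> null_vector ?R ?L (\<lambda>j i. of_bool (b i j)) (\<lambda>i. w (Inl i))" for w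
  proof -
    have "adj_null G w \<longleftrightarrow> (\<forall>v\<in>core G. (\<Sum>u\<in>nbhd G v. w u) = 0)"
      by (auto simp: adj_null_def core_def isolated)
    also have "\<dots> \<longleftrightarrow> (\<forall>i\<in>?L. (\<Sum>u\<in>nbhd G (Inl i). w u) = 0) \<and> (\<forall>j\<in>?R. (\<Sum>u\<in>nbhd G (Inr j). w u) = 0)"
      unfolding left_def right_def by (metis mem_Collect_eq sum.exhaust)
    also have "(\<forall>i\<in>?L. (\<Sum>u\<in>nbhd G (Inl i). w u) = 0)
        \<longleftrightarrow> null_vector ?L ?R (\<lambda>i j. of_bool (b i j)) (\<lambda>j. w (Inr j))"
      unfolding null_vector_def ofb[OF finLR(2)] by (simp add: nbhd_left sum.reindex)
    also have "(\<forall>j\<in>?R. (\<Sum>u\<in>nbhd G (Inr j). w u) = 0)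
        \<longleftrightarrow> null_vector ?R ?L (\<lambda>j i. of_bool (b i j)) (\<lambda>i. w (Inl i))"
      unfolding null_vector_def ofb[OF finLR(1)] by (simp add: nbhd_right sum.reindex)
    finally show ?thesis .
  qed
  have nullH: "adj_null H w \<longleftrightarrow> null_vector {..<n} {..<n} (\<lambda>i j. of_bool (b i j)) (\<lambda>j. w (Inr j))
      \<and> null_vector {..<n} {..<n} (\<lambda>j i. of_bool (b i j)) (\<lambda>i. w (Inl i))" for w
  proof -
    have nb: "nbhd H (Inl i) = Inr ` {j\<in>{..<n}. b i j}" "nbhd H (Inr i) = Inl ` {j\<in>{..<n}. b j i}"
      if "i < n" for i
      using that by (auto simp: nbhd_def H_def bip_graph_bool_mat doubleton_eq_iff)
    show ?thesis
      unfolding adj_null_def null_vector_def vertsH ball_Un ofb[OF finite_lessThan]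
      by (simp add: nb sum.reindex)
  qed
  have degL: "2 \<le> card {j\<in>?R. b i j}" if "i \<in> ?L" for i
  proof -
    have "Inl i \<in> verts G" "nbhd G (Inl i) \<noteq> {}" using that by (auto simp: left_def core_def isolated)
    then have "vdegree G (Inl i) \<noteq> 0" "vdegree G (Inl i) \<noteq> 1"
      using deg finite_nbhd[OF inv(1)] by (auto simp: vdegree_def)
    then show ?thesis by (simp add: vdegree_def nbhd_left[OF that] card_image)
  qed
  have degR: "2 \<le> card {i\<in>?L. b i j}" if "j \<in> ?R" for j
  proof -
    have "Inr j \<in> verts G" "nbhd G (Inr j) \<noteq> {}" using that by (auto simp: right_def core_def isolated)
    then have "vdegree G (Inr j) \<noteq> 0" "vdegree G (Inr j) \<noteq> 1"
      using deg finite_nbhd[OF inv(1)] by (auto simp: vdegree_def)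
    then show ?thesis by (simp add: vdegree_def nbhd_right[OF that] card_image)
  qed
  have subs: "?L \<subseteq> {..<n}" "?R \<subseteq> {..<n}" "left (isolated_verts G) \<subseteq> {..<n}"
    "right (isolated_verts G) \<subseteq> {..<n}"
    using sub vertsH by (auto simp: left_def right_def core_def isolated)
  have disj: "?L \<inter> left (isolated_verts G) = {}" "?R \<inter> right (isolated_verts G) = {}"
    by (auto simp: left_def right_def core_def)
  have vertsG: "v \<in> verts G \<longleftrightarrow> v \<in> core G \<or> v \<in> isolated_verts G" for v
    by (auto simp: core_def isolated)
  have zero: "null_vector I J A (\<lambda>_. 0)" for I J and A :: "nat \<Rightarrow> nat \<Rightarrow> real"
    by (simp add: null_vector_def)
  show "core_reduction n (\<lambda>i j. of_bool (b i j)) ?L ?R (right (isolated_verts G))"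
    unfolding core_reduction_def
  proof (intro conjI allI impI ballI)
    fix x
    assume "null_vector {..<n} {..<n} (\<lambda>i j. of_bool (b i j)) x"
    then have H: "adj_null H (case_sum (\<lambda>_. 0) x)" by (simp add: nullH zero)
    then show "null_vector ?L ?R (\<lambda>i j. of_bool (b i j)) x"
      using inv(4)[OF H] by (simp add: nullG)
    fix j assume 0: "\<forall>j\<in>?R \<union> right (isolated_verts G). x j = 0" and "j < n"
    have "\<forall>v\<in>verts G. case_sum (\<lambda>_. 0) x v = 0"
      using 0 by (auto simp: vertsG right_def split: sum.split)
    from inv(6)[OF H this] have "\<forall>v\<in>verts H. case_sum (\<lambda>_. 0) x v = 0" .
    with \<open>j < n\<close> show "x j = 0" by (force simp: vertsH)
  next
    fix x
    assume "null_vector ?L ?R (\<lambda>i j. of_bool (b i j)) x"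
    then have "adj_null G (case_sum (\<lambda>_. 0) x)" by (simp add: nullG zero)
    from inv(5)[OF this] obtain w where w: "adj_null H w" "\<forall>v\<in>verts G. w v = case_sum (\<lambda>_. 0) x v" by auto
    then show "\<exists>x'. null_vector {..<n} {..<n} (\<lambda>i j. of_bool (b i j)) x' \<and>
        (\<forall>j\<in>?R \<union> right (isolated_verts G). x' j = x j)"
      by (intro exI[of _ "\<lambda>j. w (Inr j)"]) (auto simp: nullH vertsG right_def)
  qed (use subs disj degR in auto)
  show "core_reduction n (\<lambda>j i. of_bool (b i j)) ?R ?L (left (isolated_verts G))"
    unfolding core_reduction_def
  proof (intro conjI allI impI ballI)
    fix x
    assume "null_vector {..<n} {..<n} (\<lambda>j i. of_bool (b i j)) x"
    then have H: "adj_null H (case_sum x (\<lambda>_. 0))" by (simp add: nullH zero)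
    then show "null_vector ?R ?L (\<lambda>j i. of_bool (b i j)) x"
      using inv(4)[OF H] by (simp add: nullG)
    fix j assume 0: "\<forall>j\<in>?L \<union> left (isolated_verts G). x j = 0" and "j < n"
    have "\<forall>v\<in>verts G. case_sum x (\<lambda>_. 0) v = 0"
      using 0 by (auto simp: vertsG left_def split: sum.split)
    from inv(6)[OF H this] have "\<forall>v\<in>verts H. case_sum x (\<lambda>_. 0) v = 0" .
    with \<open>j < n\<close> show "x j = 0" by (force simp: vertsH)
  next
    fix x
    assume "null_vector ?R ?L (\<lambda>j i. of_bool (b i j)) x"
    then have "adj_null G (case_sum x (\<lambda>_. 0))" by (simp add: nullG zero)
    from inv(5)[OF this] obtain w where w: "adj_null H w" "\<forall>v\<in>verts G. w v = case_sum x (\<lambda>_. 0) v" by auto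
    then show "\<exists>x'. null_vector {..<n} {..<n} (\<lambda>j i. of_bool (b i j)) x' \<and>
        (\<forall>j\<in>?L \<union> left (isolated_verts G). x' j = x j)"
      by (intro exI[of _ "\<lambda>i. w (Inl i)"]) (auto simp: nullH vertsG left_def)
  qed (use subs disj degL in auto)
  have "left (verts H) = {..<n}" "right (verts H) = {..<n}"
    by (auto simp: left_def right_def vertsH)
  then have "card (left (verts G)) = card (right (verts G))"
    using leaf_removals_balanced[OF run bip] by simp
  moreover have "left (verts G) = ?L \<union> left (isolated_verts G)"
    "right (verts G) = ?R \<union> right (isolated_verts G)"
    by (auto simp: left_def right_def vertsG)
  ultimately show "card ?L + card (left (isolated_verts G)) = card ?R + card (right (isolated_verts G))"
    using disj subs finite_subset[OF _ finite_lessThan] by (metis card_Un_disjoint)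
  have "verts (ks_core G) = core G" by (auto simp: ks_core_def delete_verts_def core_def)
  moreover have "{Inl i, Inr j} \<in> edges (ks_core G) \<longleftrightarrow> b i j" if "i \<in> ?L" "j \<in> ?R" for i j
    using that by (auto simp: ks_core_def delete_verts_def edgeG left_def right_def core_def)
  ultimately show "biadj (ks_core G) = mat (card ?L) (card ?R)
      (\<lambda>(i, j). of_bool (b (pick ?L i) (pick ?R j)))"
    unfolding biadj_def Let_def left_def[symmetric] right_def[symmetric]
    by (intro eq_matI) (auto simp: pick_in_set_le)
qed

section \<open>Circuits in the core\<close>

definition support :: "'j set \<Rightarrow> ('j \<Rightarrow> real) \<Rightarrow> 'j set" where
  "support J x = {j\<in>J. x j \<noteq> 0}"

text \<open>The circuits of the matroid of columns: supports of null vectors that are minimal under inclusion.\<close>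

definition circuit :: "'i set \<Rightarrow> 'j set \<Rightarrow> ('i \<Rightarrow> 'j \<Rightarrow> real) \<Rightarrow> 'j set \<Rightarrow> bool" where
  "circuit I J A S \<longleftrightarrow> S \<noteq> {} \<and> (\<exists>x. null_vector I J A x \<and> support J x = S) \<and>
     (\<forall>z. null_vector I J A z \<longrightarrow> support J z \<subset> S \<longrightarrow> support J z = {})"

text \<open>Take a null vector of smallest support among those that do not vanish at \<open>j\<close>. If a null vector
\<open>z\<close> had strictly smaller support, it would vanish at \<open>j\<close>, and subtracting a multiple of \<open>z\<close> would
kill another coordinate while keeping the one at \<open>j\<close>.\<close>

lemma circuit_through:
  assumes fin: "finite J" and x: "null_vector I J A x" and j: "j \<in> J" "x j \<noteq> 0"
  shows "\<exists>S. circuit I J A S \<and> j \<in> S"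
proof -
  define P where "P y \<longleftrightarrow> null_vector I J A y \<and> y j \<noteq> 0" for y
  have "P x" using x j by (simp add: P_def)
  then have "\<exists>y. P y \<and> (\<forall>z. P z \<longrightarrow> card (support J y) \<le> card (support J z))"
    by (rule ex_has_least_nat[of P x "\<lambda>y. card (support J y)"])
  then obtain y where y: "P y" and min: "\<And>z. P z \<Longrightarrow> card (support J y) \<le> card (support J z)"
    by auto
  have finS: "finite (support J z)" for z using fin by (simp add: support_def)
  have "support J z = {}" if z: "null_vector I J A z" "support J z \<subset> support J y" for z
  proof (rule ccontr)
    assume "support J z \<noteq> {}"
    then obtain k where k: "k \<in> support J z" by auto
    have "card (support J z) < card (support J y)" using z finS by (simp add: psubset_card_mono)
    with min[of z] z have zj: "z j = 0" by (auto simp: P_def)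
    define c where "c = y k / z k"
    define u where "u l = y l - c * z l" for l
    have "null_vector I J A u"
      unfolding null_vector_def
    proof
      fix i assume i: "i \<in> I"
      have "(\<Sum>l\<in>J. A i l * u l) = (\<Sum>l\<in>J. A i l * y l) - c * (\<Sum>l\<in>J. A i l * z l)"
        by (simp add: u_def right_diff_distrib sum_subtractf sum_distrib_left mult.left_commute)
      then show "(\<Sum>l\<in>J. A i l * u l) = 0"
        using y z i by (simp add: P_def null_vector_def)
    qed
    moreover have "u j \<noteq> 0" using y zj by (simp add: u_def P_def)
    ultimately have "card (support J y) \<le> card (support J u)" by (intro min) (simp add: P_def)
    moreover have "support J u \<subseteq> support J y - {k}"
    proof
      fix l assume l: "l \<in> support J u"
      have "u k = 0" using k by (simp add: u_def c_def support_def)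
      with l have "l \<noteq> k" by (auto simp: support_def)
      moreover have "l \<in> support J y"
      proof (rule ccontr)
        assume no: "l \<notin> support J y"
        then have "l \<notin> support J z" using z(2) by auto
        with no l show False by (simp add: support_def u_def)
      qed
      ultimately show "l \<in> support J y - {k}" by simp
    qed
    then have "card (support J u) < card (support J y)"
      using k z(2) finS by (intro psubset_card_mono) auto
    ultimately show False by simp
  qed
  moreover have jy: "j \<in> support J y" using y j by (simp add: support_def P_def)
  moreover have "null_vector I J A y" using y by (simp add: P_def)
  ultimately have "circuit I J A (support J y)"
    unfolding circuit_def by blast
  with jy show ?thesis by blast
qed

lemma circuit_no_smaller:
  assumes "circuit I J A S" "finite J" "S' \<subset> S"
    and z: "null_vector I S' A z" "\<forall>j. j \<notin> S' \<longrightarrow> z j = 0"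
  shows "\<forall>j. z j = 0"
proof -
  from assms(1) have "S \<subseteq> J" by (auto simp: circuit_def support_def)
  have "(\<Sum>j\<in>J. A i j * z j) = (\<Sum>j\<in>S'. A i j * z j)" for i
    using z(2) assms(2,3) \<open>S \<subseteq> J\<close> by (intro sum.mono_neutral_right) auto
  then have "null_vector I J A z" using z(1) by (simp add: null_vector_def)
  moreover have "support J z \<subset> S" using z(2) assms(3) by (auto simp: support_def)
  ultimately have "support J z = {}" using assms(1) by (auto simp: circuit_def)
  then show ?thesis using z(2) \<open>S \<subseteq> J\<close> assms(3) by (auto simp: support_def)
qed

text \<open>With fewer rows meeting \<open>S\<close>, the columns in \<open>S\<close> would still be dependent after
one of them is dropped.\<close>

lemma circuit_card_rows:
  assumes C: "circuit I J A S" and fin: "finite I" "finite J"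
  shows "card S \<le> Suc (card {i\<in>I. \<exists>j\<in>S. A i j \<noteq> 0})"
proof (rule ccontr)
  define N where "N = {i\<in>I. \<exists>j\<in>S. A i j \<noteq> 0}"
  assume "\<not> card S \<le> Suc (card {i\<in>I. \<exists>j\<in>S. A i j \<noteq> 0})"
  then have big: "Suc (card N) < card S" by (simp add: N_def)
  from C have "S \<subseteq> J" by (auto simp: circuit_def support_def)
  then have finS: "finite S" using fin finite_subset by auto
  obtain j0 where j0: "j0 \<in> S" using C by (auto simp: circuit_def)
  have "card N < card (S - {j0})" using big j0 finS by simp
  with underdetermined_null_vector[of N "S - {j0}" A] fin finS
  obtain z where z: "null_vector N (S - {j0}) A z" "\<exists>j\<in>S - {j0}. z j \<noteq> 0"
    "\<forall>j. j \<notin> S - {j0} \<longrightarrow> z j = 0" by (auto simp: N_def)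
  have "null_vector I (S - {j0}) A z"
    using z(1) by (fastforce simp: null_vector_def N_def intro: sum.neutral)
  from circuit_no_smaller[OF C fin(2) _ this z(3)] j0 z(2) show False by auto
qed

text \<open>The columns in the support of \<open>x\<close> are dependent, so a row basis of this submatrix has fewer rows
than columns, and it imposes the same conditions as all rows together. In the random matrix the
rows outside \<open>T\<close> are independent of any null vector chosen from the rows in \<open>T\<close>.\<close>

lemma determining_rows:
  assumes x: "null_vector I J A x" and fin: "finite I" "finite J" and ne: "support J x \<noteq> {}"
  shows "\<exists>T\<subseteq>I. card T < card (support J x) \<and>
    (\<forall>z. support J z \<subseteq> support J x \<longrightarrow> null_vector T J A z \<longrightarrow> null_vector I J A z)"
proof -
  define S where "S = support J x"
  have S: "S \<subseteq> J" "finite S" using fin by (auto simp: S_def support_def)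
  have sumS: "(\<Sum>j\<in>J. A i j * z j) = (\<Sum>j\<in>S. A i j * z j)" if "support J z \<subseteq> S" for i z
    using that S fin by (intro sum.mono_neutral_right) (auto simp: support_def)
  obtain T where T: "T \<subseteq> I" "indep_columns S T (\<lambda>j i. A i j)" "spanning_columns S I T (\<lambda>j i. A i j)"
    using column_basis_exists[OF fin(1), of S "\<lambda>j i. A i j"] by auto
  have finT: "finite T" using T fin finite_subset by auto
  have swap: "(\<Sum>t\<in>T. y t * (\<Sum>j\<in>S. A t j * z j)) = (\<Sum>j\<in>S. z j * (\<Sum>t\<in>T. A t j * y t))" for y z
    unfolding sum_distrib_left by (subst sum.swap) (simp add: algebra_simps)
  have "card T < card S"
  proof (rule ccontr)
    assume "\<not> card T < card S"
    obtain j0 where j0: "j0 \<in> S" using ne by (auto simp: S_def)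
    with \<open>\<not> card T < card S\<close> S have "card (S - {j0}) < card T"
      by (metis card_Diff1_less not_less order_less_le_trans)
    from underdetermined_null_vector[OF _ finT this, of "\<lambda>j i. A i j"] S
    obtain y t where y: "null_vector (S - {j0}) T (\<lambda>j i. A i j) y" "t \<in> T" "y t \<noteq> 0" by auto
    have "0 = (\<Sum>t\<in>T. y t * (\<Sum>j\<in>S. A t j * x j))"
      using x T(1) sumS[of x] by (intro sum.neutral[symmetric]) (auto simp: null_vector_def S_def)
    also have "\<dots> = x j0 * (\<Sum>t\<in>T. A t j0 * y t) + (\<Sum>j\<in>S - {j0}. x j * (\<Sum>t\<in>T. A t j * y t))"
      unfolding swap using j0 S by (simp add: sum.remove)
    also have "(\<Sum>j\<in>S - {j0}. x j * (\<Sum>t\<in>T. A t j * y t)) = 0"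
      using y(1) by (intro sum.neutral) (simp add: null_vector_def)
    finally have "(\<Sum>t\<in>T. A t j0 * y t) = 0" using j0 by (auto simp: S_def support_def)
    with y(1) have "null_vector S T (\<lambda>j i. A i j) y" by (auto simp: null_vector_def)
    with T(2) y show False by (auto simp: indep_columns_def)
  qed
  moreover have "null_vector I J A z" if z: "support J z \<subseteq> S" "null_vector T J A z" for z
    unfolding null_vector_def sumS[OF z(1)]
  proof
    fix i assume "i \<in> I"
    with T(3) obtain c where c: "\<forall>j\<in>S. A i j = (\<Sum>t\<in>T. A t j * c t)"
      by (auto simp: spanning_columns_def)
    have "(\<Sum>j\<in>S. A i j * z j) = (\<Sum>j\<in>S. z j * (\<Sum>t\<in>T. A t j * c t))"
      using c by (intro sum.cong) auto
    also have "\<dots> = (\<Sum>t\<in>T. c t * (\<Sum>j\<in>S. A t j * z j))" by (rule swap[symmetric])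
    also have "\<dots> = 0"
      using z(2) sumS[OF z(1)] by (intro sum.neutral) (auto simp: null_vector_def)
    finally show "(\<Sum>j\<in>S. A i j * z j) = 0" .
  qed
  ultimately show ?thesis using T(1) unfolding S_def by blast
qed

text \<open>A row meeting the support in one place only would give a single nonzero summand.\<close>

lemma null_vector_row_card_ne_1:
  assumes "null_vector I J A x" "i \<in> I" "finite J"
  shows "card {j\<in>support J x. A i j \<noteq> 0} \<noteq> 1"
proof
  assume "card {j\<in>support J x. A i j \<noteq> 0} = 1"
  then obtain k where k: "{j\<in>support J x. A i j \<noteq> 0} = {k}" by (auto simp: card_1_singleton_iff)
  then have kJ: "k \<in> J" "A i k * x k \<noteq> 0" by (auto simp: support_def)
  have "(\<Sum>j\<in>J. A i j * x j) = (\<Sum>j\<in>{k}. A i j * x j)"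
    using k kJ assms(3) by (intro sum.mono_neutral_right) (auto simp: support_def)
  with assms kJ show False by (simp add: null_vector_def)
qed

text \<open>The hypotheses \<open>few\<close> and \<open>two\<close> describe a circuit whose bipartite graph is a tree with rows of
degree two (in a circuit, \<open>few\<close> forces \<open>card S - 1\<close> rows); such trees do occur at small sizes in
the random matrix, but leaf removal destroys them. Let \<open>S0\<close> be the core part of the circuit and
\<open>N0\<close> the core rows meeting it. A null vector restricts to a null vector of the core, so each row in \<open>N0\<close>
has both its entries inside \<open>S0\<close>; as the columns in \<open>S0\<close> have degree at least two in the core,
double counting gives \<open>card S0 \<le> card N0\<close>. Then too few rows are left for the columns in \<open>S - S0\<close>, which
therefore carry a null vector on their own.\<close>

lemma no_sparse_circuit_in_core:
  assumes red: "core_reduction n A L R Z"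
    and C: "circuit {..<n} {..<n} A S" and meet: "S \<inter> R \<noteq> {}"
    and few: "card {i\<in>{..<n}. \<exists>j\<in>S. A i j \<noteq> 0} < card S"
    and two: "\<forall>i\<in>{i\<in>{..<n}. \<exists>j\<in>S. A i j \<noteq> 0}. card {j\<in>S. A i j \<noteq> 0} = 2"
  shows False
proof -
  obtain x where x: "null_vector {..<n} {..<n} A x" "support {..<n} x = S"
    using C by (auto simp: circuit_def)
  define N where "N = {i\<in>{..<n}. \<exists>j\<in>S. A i j \<noteq> 0}"
  define S0 where "S0 = S \<inter> R"
  define N0 where "N0 = {i\<in>L. \<exists>j\<in>S0. A i j \<noteq> 0}"
  have LR: "L \<subseteq> {..<n}" "R \<subseteq> {..<n}" "null_vector L R A x"
    "\<And>j. j \<in> R \<Longrightarrow> 2 \<le> card {i\<in>L. A i j \<noteq> 0}"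
    using red x by (auto simp: core_reduction_def)
  have Sn: "S \<subseteq> {..<n}" using x by (auto simp: support_def)
  have "finite S" "finite L" "finite R"
    using Sn LR(1,2) finite_subset[OF _ finite_lessThan] by metis+
  then have fin: "finite S" "finite S0" "finite N" "finite N0" "finite L" "finite R"
    by (simp_all add: S0_def N_def N0_def)
  have N0N: "N0 \<subseteq> N" using LR by (auto simp: N0_def N_def S0_def)
  have S0: "support R x = S0" using x(2) LR(2) by (auto simp: S0_def support_def)
  have row0: "card {j\<in>S0. A i j \<noteq> 0} = 2" "{j\<in>S. A i j \<noteq> 0} \<subseteq> S0" if i: "i \<in> N0" for i
  proof -
    have "card {j\<in>S0. A i j \<noteq> 0} \<noteq> 1"
      using null_vector_row_card_ne_1[OF LR(3), of i] i fin by (simp add: S0 N0_def)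
    moreover have "card {j\<in>S0. A i j \<noteq> 0} \<noteq> 0" using i fin by (auto simp: N0_def)
    moreover have sub: "{j\<in>S0. A i j \<noteq> 0} \<subseteq> {j\<in>S. A i j \<noteq> 0}" by (auto simp: S0_def)
    have "card {j\<in>S. A i j \<noteq> 0} = 2" using two N0N i by (auto simp: N_def)
    moreover have "card {j\<in>S0. A i j \<noteq> 0} \<le> card {j\<in>S. A i j \<noteq> 0}"
      using sub fin by (intro card_mono) auto
    ultimately show eq: "card {j\<in>S0. A i j \<noteq> 0} = 2" by linarith
    then have "{j\<in>S0. A i j \<noteq> 0} = {j\<in>S. A i j \<noteq> 0}"
      using sub fin \<open>card {j\<in>S. A i j \<noteq> 0} = 2\<close> by (intro card_subset_eq) auto
    then show "{j\<in>S. A i j \<noteq> 0} \<subseteq> S0" by auto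
  qed
  have "2 * card S0 = (\<Sum>j\<in>S0. 2)" by simp
  also have "\<dots> \<le> (\<Sum>j\<in>S0. card {i\<in>N0. A i j \<noteq> 0})"
  proof (rule sum_mono)
    fix j assume j: "j \<in> S0"
    then have "{i\<in>L. A i j \<noteq> 0} = {i\<in>N0. A i j \<noteq> 0}" by (auto simp: N0_def)
    with LR(4)[of j] j show "2 \<le> card {i\<in>N0. A i j \<noteq> 0}" by (auto simp: S0_def)
  qed
  also have "\<dots> = (\<Sum>i\<in>N0. 2)"
    using row0(1) fin by (intro sum_multicount_gen) auto
  finally have S0N0: "card S0 \<le> card N0" by simp
  have "card (N - N0) = card N - card N0" using N0N fin by (simp add: card_Diff_subset)
  moreover have "card N0 \<le> card N" using N0N fin by (simp add: card_mono)
  moreover have "card (S - S0) = card S - card S0" using fin by (intro card_Diff_subset) (auto simp: S0_def)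
  moreover have "card S0 \<le> card S" using fin by (intro card_mono) (auto simp: S0_def)
  ultimately have "card (N - N0) < card (S - S0)" using few S0N0 by (simp add: N_def)
  with underdetermined_null_vector[of "N - N0" "S - S0" A] fin obtain z where
    z: "null_vector (N - N0) (S - S0) A z" "\<exists>j\<in>S - S0. z j \<noteq> 0" "\<forall>j. j \<notin> S - S0 \<longrightarrow> z j = 0"
    by auto
  have "null_vector {..<n} (S - S0) A z"
    unfolding null_vector_def
  proof
    fix i assume i: "i \<in> {..<n}"
    show "(\<Sum>j\<in>S - S0. A i j * z j) = 0"
    proof (cases "i \<in> N - N0")
      case True
      then show ?thesis using z(1) by (simp add: null_vector_def)
    next
      case False
      have "A i j = 0" if "j \<in> S - S0" for j
      proof (rule ccontr)
        assume "A i j \<noteq> 0"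
        then have "i \<in> N0" using False i that by (auto simp: N_def)
        from row0(2)[OF this] that \<open>A i j \<noteq> 0\<close> show False by auto
      qed
      then show ?thesis by simp
    qed
  qed
  moreover have "S - S0 \<subset> S" using meet by (auto simp: S0_def)
  ultimately have "\<forall>j. z j = 0" using circuit_no_smaller[OF C _ _ _ z(3)] by auto
  with z(2) show False by auto
qed

text \<open>The trace of a core null vector in the full matrix: no row meets \<open>S\<close> exactly once, and there
are at least \<open>card S\<close> rows meeting it at least twice, or one fewer with some row meeting it at least three
times. Compared with a tree this is at least one excess edge, which makes the expected number of small sets \<open>S\<close>
of this kind tend to zero.\<close>

definition surplus :: "nat \<Rightarrow> (nat \<Rightarrow> nat \<Rightarrow> bool) \<Rightarrow> nat set \<Rightarrow> bool" where
  "surplus n b S \<longleftrightarrow> (\<forall>i<n. card {j\<in>S. b i j} \<noteq> 1) \<and>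
     ((\<exists>T\<subseteq>{..<n}. card T = card S \<and> (\<forall>i\<in>T. 2 \<le> card {j\<in>S. b i j})) \<or>
      (\<exists>T\<subseteq>{..<n}. Suc (card T) = card S \<and> (\<forall>i\<in>T. 2 \<le> card {j\<in>S. b i j}) \<and>
         (\<exists>i\<in>T. 3 \<le> card {j\<in>S. b i j})))"

text \<open>Extend the core null vector to the full matrix and pass to a circuit through \<open>j\<close>.\<close>

lemma core_null_vector_surplus:
  assumes red: "core_reduction n (\<lambda>i j. of_bool (b i j)) L R Z"
    and x: "null_vector L R (\<lambda>i j. of_bool (b i j)) x" "j \<in> R" "x j \<noteq> 0"
  shows "\<exists>x'. null_vector {..<n} {..<n} (\<lambda>i j. of_bool (b i j)) x' \<and> support {..<n} x' \<noteq> {} \<and>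
    surplus n b (support {..<n} x')"
proof -
  let ?A = "\<lambda>i j. of_bool (b i j) :: real"
  obtain x1 where x1: "null_vector {..<n} {..<n} ?A x1" "x1 j \<noteq> 0"
    using red x by (auto simp: core_reduction_def)
  have "j < n" using red x by (auto simp: core_reduction_def)
  with circuit_through[OF _ x1(1) _ x1(2)] obtain S where S: "circuit {..<n} {..<n} ?A S" "j \<in> S" by auto
  then obtain x' where x': "null_vector {..<n} {..<n} ?A x'" "support {..<n} x' = S"
    by (auto simp: circuit_def)
  have Sn: "S \<subseteq> {..<n}" using x'(2) by (auto simp: support_def)
  then have fin: "finite S" using finite_subset by auto
  define N where "N = {i\<in>{..<n}. \<exists>j\<in>S. ?A i j \<noteq> 0}"
  have ne1: "card {j\<in>S. b i j} \<noteq> 1" if "i < n" for i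
    using null_vector_row_card_ne_1[OF x'(1), of i] that by (simp add: x'(2))
  have N2: "2 \<le> card {j\<in>S. b i j}" if "i \<in> N" for i
  proof -
    have "card {j\<in>S. b i j} \<noteq> 0" using that fin by (auto simp: N_def)
    moreover have "card {j\<in>S. b i j} \<noteq> 1" using that ne1 by (simp add: N_def)
    ultimately show ?thesis by linarith
  qed
  have "surplus n b S"
  proof (cases "card S \<le> card N")
    case True
    then obtain T where "T \<subseteq> N" "card T = card S" using obtain_subset_with_card_n by metis
    moreover have "N \<subseteq> {..<n}" by (auto simp: N_def)
    ultimately show ?thesis unfolding surplus_def using ne1 N2
      by (intro conjI disjI1 exI[of _ T]) auto
  next
    case False
    have "card S \<le> Suc (card N)" using circuit_card_rows[OF S(1)] by (simp add: N_def)
    with False have "Suc (card N) = card S" by simp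
    moreover have "\<not> (\<forall>i\<in>N. card {j\<in>S. ?A i j \<noteq> 0} = 2)"
      using no_sparse_circuit_in_core[OF red S(1)] S(2) x(2) False unfolding N_def by auto
    then obtain i where i: "i \<in> N" "card {j\<in>S. b i j} \<noteq> 2" by auto
    with N2[OF i(1)] have "3 \<le> card {j\<in>S. b i j}" by linarith
    ultimately show ?thesis unfolding surplus_def using ne1 N2 i(1)
      by (intro conjI disjI2 exI[of _ N]) (auto simp: N_def)
  qed
  with x' S show ?thesis by (intro exI[of _ x']) auto
qed

section \<open>Corank of the full matrix\<close>

lemma bij_betw_pick:
  assumes "finite S"
  shows "bij_betw (pick S) {..<card S} S"
proof (rule bij_betw_imageI)
  show "inj_on (pick S) {..<card S}"
    by (rule inj_onI) (metis card_pick lessThan_iff)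
  show "pick S ` {..<card S} = S"
  proof (intro equalityI subsetI)
    fix i assume i: "i \<in> S"
    then have "card {a\<in>S. a < i} < card S" using assms by (intro psubset_card_mono) auto
    then show "i \<in> pick S ` {..<card S}" using pick_card_in_set[OF i]
      by (intro image_eqI[of _ _ "card {a\<in>S. a < i}"]) auto
  qed (use pick_in_set_le in auto)
qed

lemma corank_pick_eq_0:
  assumes fin: "finite L" "finite R" and triv: "indep_columns R L (\<lambda>j i. A i j)"
  shows "corank (mat (card L) (card R) (\<lambda>(i, j). A (pick L i) (pick R j))) = 0"
proof -
  define M where "M = mat (card L) (card R) (\<lambda>(i, j). A (pick L i) (pick R j))"
  have M: "M \<in> carrier_mat (card L) (card R)" by (simp add: M_def)
  note bijL = bij_betw_pick[OF fin(1)] and bijR = bij_betw_pick[OF fin(2)]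
  have "vec_space.rank (card L) M = card L - card ({} :: nat set)"
  proof (rule rank_eq_of_left_null_space_coordinates[OF M])
    fix y assume y: "null_vector {..<card R} {..<card L} (\<lambda>j i. M $$ (i, j)) y"
    define y' where "y' i = y (the_inv_into {..<card L} (pick L) i)" for i
    have y': "y' (pick L k) = y k" if "k < card L" for k
      using that bijL by (simp add: y'_def bij_betw_def the_inv_into_f_f)
    have "null_vector R L (\<lambda>j i. A i j) y'"
      unfolding null_vector_def
    proof
      fix j assume "j \<in> R"
      then obtain l where l: "l < card R" "j = pick R l" using bijR by (auto simp: bij_betw_def)
      have "(\<Sum>i\<in>L. A i j * y' i) = (\<Sum>k<card L. A (pick L k) j * y' (pick L k))"
        using sum.reindex_bij_betw[OF bijL, of "\<lambda>i. A i j * y' i"] by simp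
      also have "\<dots> = (\<Sum>k<card L. M $$ (k, l) * y k)"
        using l by (intro sum.cong) (auto simp: M_def y')
      also have "\<dots> = 0" using y l by (simp add: null_vector_def)
      finally show "(\<Sum>i\<in>L. A i j * y' i) = 0" .
    qed
    with triv have "\<forall>i\<in>L. y' i = 0" by (auto simp: indep_columns_def)
    then show "\<forall>k<card L. y k = 0" using y' bijL by (force simp: bij_betw_def)
  qed auto
  moreover have "dim_row M = card L" by (simp add: M_def)
  ultimately show ?thesis unfolding corank_def M_def[symmetric] by simp
qed

lemma
  assumes cr: "core_reduction n A L R Z" and tr: "indep_columns L R A"
  shows core_reduction_isolated_coordinates:
      "j \<in> Z \<Longrightarrow> \<exists>x. null_vector {..<n} {..<n} A x \<and> (\<forall>k\<in>Z. x k = of_bool (k = j))"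
    and core_reduction_null_vector_eq_0:
      "null_vector {..<n} {..<n} A x \<Longrightarrow> \<forall>j\<in>Z. x j = 0 \<Longrightarrow> \<forall>j<n. x j = 0"
proof -
  show "\<exists>x. null_vector {..<n} {..<n} A x \<and> (\<forall>k\<in>Z. x k = of_bool (k = j))" if "j \<in> Z"
  proof -
    have "R \<inter> Z = {}" using cr by (simp add: core_reduction_def)
    then have "null_vector L R A (\<lambda>k. of_bool (k = j))"
      using that by (auto simp: null_vector_def intro!: sum.neutral)
    moreover have "\<forall>x. null_vector L R A x \<longrightarrow>
        (\<exists>x'. null_vector {..<n} {..<n} A x' \<and> (\<forall>k\<in>R \<union> Z. x' k = x k))"
      using cr by (simp add: core_reduction_def)
    ultimately obtain x where "null_vector {..<n} {..<n} A x" "\<forall>k\<in>R \<union> Z. x k = of_bool (k = j)"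
      by meson
    then show ?thesis by auto
  qed
  show "\<forall>j<n. x j = 0" if x: "null_vector {..<n} {..<n} A x" "\<forall>j\<in>Z. x j = 0"
  proof -
    have "null_vector L R A x" using cr x(1) by (simp add: core_reduction_def)
    with tr have "\<forall>j\<in>R. x j = 0" by (auto simp: indep_columns_def)
    with x have "\<forall>j\<in>R \<union> Z. x j = 0" by auto
    with cr x(1) show ?thesis by (simp add: core_reduction_def)
  qed
qed

lemma indep_columns_card_le:
  assumes "indep_columns L R A" "finite L" "finite R"
  shows "card R \<le> card L"
proof (rule ccontr)
  assume "\<not> card R \<le> card L"
  with underdetermined_null_vector[OF assms(2,3), of A] assms(1) show False
    by (auto simp: indep_columns_def)
qed

text \<open>If the core has no right null vector, the right null space of the full matrix has the isolated
columns as coordinates, so the corank is their number. In that case the core has at least as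
many rows as columns, hence, the removed parts being balanced, at least as many columns as rows
are isolated, and the number of isolated columns is the maximum. The other case is symmetric.\<close>

lemma
  assumes ks: "karp_sipser (bip_graph (bool_mat n b)) G"
    and triv: "indep_columns (left (core G)) (right (core G)) (\<lambda>i j. of_bool (b i j)) \<or>
      indep_columns (right (core G)) (left (core G)) (\<lambda>j i. of_bool (b i j))"
  shows corank_core_eq_0: "corank (biadj (ks_core G)) = 0 \<or>
      corank (transpose_mat (biadj (ks_core G))) = 0"
    and corank_eq_isolated: "corank (bool_mat n b) =
      max (card (isolated_verts G \<inter> Inl ` {..<n})) (card (isolated_verts G \<inter> Inr ` {..<n}))"
proof -
  let ?A = "\<lambda>i j. of_bool (b i j) :: real"
  let ?L = "left (core G)" and ?R = "right (core G)"
  define IL where "IL = left (isolated_verts G)"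
  define IR where "IR = right (isolated_verts G)"
  note red = karp_sipser_core_reduction[OF ks, folded IR_def]
    and redT = karp_sipser_core_reduction_transpose[OF ks, folded IL_def]
    and bal = karp_sipser_balanced[OF ks, folded IL_def IR_def]
    and biadj = karp_sipser_biadj[OF ks]
  have sub: "?L \<subseteq> {..<n}" "?R \<subseteq> {..<n}" "IL \<subseteq> {..<n}" "IR \<subseteq> {..<n}"
    using red redT by (auto simp: core_reduction_def)
  then have fin: "finite ?L" "finite ?R" "finite IL" "finite IR"
    using finite_subset[OF _ finite_lessThan] by metis+
  show "corank (biadj (ks_core G)) = 0 \<or> corank (transpose_mat (biadj (ks_core G))) = 0"
    using triv
  proof
    assume "indep_columns ?R ?L (\<lambda>j i. ?A i j)"
    from corank_pick_eq_0[OF fin(1,2) this] show ?thesis unfolding biadj by simp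
  next
    assume "indep_columns ?L ?R ?A"
    from corank_pick_eq_0[OF fin(2,1) this]
    have "corank (mat (card ?R) (card ?L) (\<lambda>(j, i). ?A (pick ?L i) (pick ?R j))) = 0" .
    also have "mat (card ?R) (card ?L) (\<lambda>(j, i). ?A (pick ?L i) (pick ?R j))
        = transpose_mat (biadj (ks_core G))"
      unfolding biadj by (intro eq_matI) auto
    finally show ?thesis by simp
  qed
  have M: "bool_mat n b \<in> carrier_mat n n" by (simp add: bool_mat_def)
  have nullM: "null_vector {..<n} {..<n} (\<lambda>i j. bool_mat n b $$ (i, j)) x
      \<longleftrightarrow> null_vector {..<n} {..<n} ?A x"
    "null_vector {..<n} {..<n} (\<lambda>j i. bool_mat n b $$ (i, j)) x
      \<longleftrightarrow> null_vector {..<n} {..<n} (\<lambda>j i. ?A i j) x" for x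
    by (simp_all add: null_vector_def bool_mat_def)
  have cards: "card (isolated_verts G \<inter> Inl ` {..<n}) = card IL"
    "card (isolated_verts G \<inter> Inr ` {..<n}) = card IR"
  proof -
    have "isolated_verts G \<inter> Inl ` {..<n} = Inl ` IL" "isolated_verts G \<inter> Inr ` {..<n} = Inr ` IR"
      using sub by (auto simp: IL_def IR_def left_def right_def)
    then show "card (isolated_verts G \<inter> Inl ` {..<n}) = card IL"
      "card (isolated_verts G \<inter> Inr ` {..<n}) = card IR"
      by (simp_all add: card_image)
  qed
  have dim: "dim_row (bool_mat n b) = n" by (simp add: bool_mat_def)
  have le_n: "card IL \<le> n" "card IR \<le> n"
    using card_mono[OF finite_lessThan sub(3)] card_mono[OF finite_lessThan sub(4)] by simp_all
  show "corank (bool_mat n b) =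
      max (card (isolated_verts G \<inter> Inl ` {..<n})) (card (isolated_verts G \<inter> Inr ` {..<n}))"
    using triv
  proof
    assume tr: "indep_columns ?L ?R ?A"
    have "vec_space.rank n (bool_mat n b) = n - card IR"
      by (rule rank_eq_of_null_space_coordinates[OF M sub(4)];
          unfold nullM; rule core_reduction_isolated_coordinates[OF red tr]
            core_reduction_null_vector_eq_0[OF red tr])
    then have "corank (bool_mat n b) = card IR" using le_n by (simp add: corank_def dim)
    moreover have "card IL \<le> card IR" using indep_columns_card_le[OF tr] fin bal by simp
    ultimately show ?thesis unfolding cards by simp
  next
    assume tr: "indep_columns ?R ?L (\<lambda>j i. ?A i j)"
    have "vec_space.rank n (bool_mat n b) = n - card IL"
      by (rule rank_eq_of_left_null_space_coordinates[OF M sub(3)];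
          unfold nullM; rule core_reduction_isolated_coordinates[OF redT tr]
            core_reduction_null_vector_eq_0[OF redT tr])
    then have "corank (bool_mat n b) = card IL" using le_n by (simp add: corank_def dim)
    moreover have "card IR \<le> card IL" using indep_columns_card_le[OF tr] fin bal by simp
    ultimately show ?thesis unfolding cards by simp
  qed
qed

lemma both_null_spaces_of_core_nontrivial:
  assumes ks: "karp_sipser (bip_graph (bool_mat n b)) G"
    and nontriv: "\<not> indep_columns (left (core G)) (right (core G)) (\<lambda>i j. of_bool (b i j))"
      "\<not> indep_columns (right (core G)) (left (core G)) (\<lambda>j i. of_bool (b i j))"
  shows "\<exists>x. null_vector {..<n} {..<n} (\<lambda>i j. of_bool (b i j)) x \<and> support {..<n} x \<noteq> {} \<and>
      surplus n b (support {..<n} x)"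
    and "\<exists>y. null_vector {..<n} {..<n} (\<lambda>j i. of_bool (b i j)) y \<and> support {..<n} y \<noteq> {} \<and>
      surplus n (\<lambda>j i. b i j) (support {..<n} y)"
  using nontriv core_null_vector_surplus[OF karp_sipser_core_reduction[OF ks]]
    core_null_vector_surplus[OF karp_sipser_core_reduction_transpose[OF ks]]
  unfolding indep_columns_def by metis+

section \<open>A Littlewood-Offord inequality for biased bits\<close>

abbreviation bits :: "'i set \<Rightarrow> real \<Rightarrow> ('i \<Rightarrow> bool) pmf" where
  "bits A p \<equiv> Pi_pmf A False (\<lambda>_. bernoulli_pmf p)"

lemma finite_set_bits: "finite A \<Longrightarrow> finite (set_pmf (bits A p))"
  by (rule finite_subset[OF set_Pi_pmf_subset']) auto

lemma integrable_bits: "finite A \<Longrightarrow> integrable (measure_pmf (bits A p)) (g :: _ \<Rightarrow> real)"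
  by (rule integrable_measure_pmf_finite) (rule finite_set_bits)

lemma expectation_bits_split:
  fixes g :: "('i \<Rightarrow> bool) \<Rightarrow> real" and p :: real
  assumes "finite A" "i \<in> A" and p: "0 \<le> p" "p \<le> 1"
  shows "measure_pmf.expectation (bits A p) g =
    p * measure_pmf.expectation (bits (A - {i}) p) (\<lambda>f. g (f(i := True))) +
    (1 - p) * measure_pmf.expectation (bits (A - {i}) p) (\<lambda>f. g (f(i := False)))"
proof -
  have "bits A p = bits (insert i (A - {i})) p" using assms by (simp add: insert_absorb)
  also have "\<dots> = bernoulli_pmf p \<bind> (\<lambda>y. map_pmf (\<lambda>f. f(i := y)) (bits (A - {i}) p))"
    using assms by (subst Pi_pmf_insert') (auto simp: map_pmf_def)
  finally have eq: "bits A p = \<dots>" .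
  show ?thesis
    unfolding eq
    by (subst pmf_expectation_bind[where A = UNIV])
      (use assms in \<open>auto simp: finite_set_bits UNIV_bool\<close>)
qed

text \<open>Conditioning on one bit; the functions on the right ignore this bit.\<close>

lemma expectation_bits_times_bit:
  fixes g :: "('i \<Rightarrow> bool) \<Rightarrow> real" and p :: real
  assumes "finite A" "i \<in> A" and p: "0 \<le> p" "p \<le> 1"
  shows "measure_pmf.expectation (bits A p) (\<lambda>b. of_bool (b i) * g b) =
      p * measure_pmf.expectation (bits A p) (\<lambda>b. g (b(i := True)))"
    and "measure_pmf.expectation (bits A p) (\<lambda>b. of_bool (\<not> b i) * g b) =
      (1 - p) * measure_pmf.expectation (bits A p) (\<lambda>b. g (b(i := False)))"
  using assms by (simp_all add: expectation_bits_split[OF assms] algebra_simps)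

lemma expectation_bits_covariance:
  fixes g :: "('i \<Rightarrow> bool) \<Rightarrow> real" and p :: real
  assumes "finite A" "i \<in> A" and p: "0 \<le> p" "p \<le> 1"
  shows "measure_pmf.expectation (bits A p) (\<lambda>b. (of_bool (b i) - p) * g b) =
    p * (1 - p) * measure_pmf.expectation (bits A p) (\<lambda>b. g (b(i := True)) - g (b(i := False)))"
proof -
  note int = integrable_bits[OF assms(1)]
  have "measure_pmf.expectation (bits A p) (\<lambda>b. (of_bool (b i) - p) * g b) =
      measure_pmf.expectation (bits A p) (\<lambda>b. (1 - p) * (of_bool (b i) * g b) - p * (of_bool (\<not> b i) * g b))"
    by (intro Bochner_Integration.integral_cong) (auto simp: algebra_simps)
  also have "\<dots> = p * (1 - p) * measure_pmf.expectation (bits A p) (\<lambda>b. g (b(i := True)) - g (b(i := False)))"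
    by (simp add: int expectation_bits_times_bit[OF assms]) (simp add: algebra_simps)
  finally show ?thesis .
qed

text \<open>Compare the level set \<open>s = a\<close> with the up-set \<open>s \<ge> a\<close>, whose indicator is \<open>u\<close>. On the level set every
bit \<open>i \<in> P\<close> that is one is pivotal for the up-set, because switching it off decreases \<open>s\<close>. So
the covariance of \<open>u\<close> with the centred number \<open>w\<close> of ones in \<open>P\<close>, which is the total
influence up to a factor \<open>p (1 - p)\<close>, is at least \<open>1 - p\<close> times the expected number of ones on the
level set. On the other hand the covariance is at most the mean absolute value of \<open>w\<close>, that is, at most
the standard deviation, of order \<open>sqrt (card P * p)\<close>; and the number of ones is
about \<open>card P * p\<close>. Dividing gives the bound, with no combinatorics of antichains.\<close>

lemma littlewood_offord_positive:
  fixes x :: "'i \<Rightarrow> real" and p a :: real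
  assumes A: "finite A" and p: "0 < p" "p \<le> 1/2"
    and P: "P \<subseteq> A" "\<And>i. i \<in> P \<Longrightarrow> x i > 0" "P \<noteq> {}"
  shows "measure_pmf.prob (bits A p) {b. (\<Sum>i\<in>A. of_bool (b i) * x i) = a} \<le> 3 / sqrt (card P * p)"
proof -
  let ?E = "measure_pmf.expectation (bits A p)"
  note int = integrable_bits[OF A]
  have p01: "0 \<le> p" "p \<le> 1" using p by auto
  define s where "s b = (\<Sum>i\<in>A. of_bool (b i) * x i)" for b
  define u where "u b = (of_bool (a \<le> s b) :: real)" for b
  define f where "f b = (of_bool (s b = a) :: real)" for b
  define w where "w b = (\<Sum>i\<in>P. of_bool (b i) - p)" for b :: "'i \<Rightarrow> bool"
  define m where "m = real (card P)"
  define t where "t = sqrt (m * p)"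
  have finP: "finite P" using P(1) A finite_subset by auto
  have m: "m > 0" using P(3) finP by (simp add: m_def card_gt_0_iff)
  have t: "t > 0" "t * t = m * p" using m p by (auto simp: t_def)
  have s_upd: "s (b(i := True)) = s (b(i := False)) + x i" if "i \<in> A" for b i
  proof -
    have "s (b(i := y)) = of_bool y * x i + (\<Sum>j\<in>A - {i}. of_bool (b j) * x j)" for y
      unfolding s_def using A that by (subst sum.remove[of _ i]) (auto intro!: sum.cong)
    then show ?thesis by simp
  qed
  have w_upd: "w (b(i := True)) - w (b(i := False)) = 1" if "i \<in> P" for b i
  proof -
    have "w (b(i := y)) = of_bool y - p + (\<Sum>j\<in>P - {i}. of_bool (b j) - p)" for y
      unfolding w_def using finP that by (subst sum.remove[of _ i]) (auto intro!: sum.cong)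
    then show ?thesis by simp
  qed
  have E_w: "?E (\<lambda>b. w b * g b) = (\<Sum>i\<in>P. ?E (\<lambda>b. (of_bool (b i) - p) * g b))" for g
    unfolding w_def sum_distrib_right by (simp add: int)
  have "?E (\<lambda>b. w b * w b) = (\<Sum>i\<in>P. p * (1 - p) * ?E (\<lambda>b. w (b(i := True)) - w (b(i := False))))"
    unfolding E_w using P(1) by (intro sum.cong refl expectation_bits_covariance A p01) auto
  also have "\<dots> = m * (p * (1 - p))" using w_upd by (simp add: m_def)
  also have "\<dots> \<le> m * p" using m p by (intro mult_left_mono) (auto simp: mult_le_cancel_left2)
  finally have var: "?E (\<lambda>b. w b * w b) \<le> t * t" using t by simp
  have abs: "?E (\<lambda>b. \<bar>w b\<bar>) \<le> t"
  proof -
    have "?E (\<lambda>b. \<bar>w b\<bar>) \<le> ?E (\<lambda>b. t / 2 + (w b * w b) * (1 / (2 * t)))"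
    proof (rule integral_mono[OF int int])
      fix b
      have "0 \<le> (\<bar>w b\<bar> - t)\<^sup>2" by simp
      then have "2 * t * \<bar>w b\<bar> \<le> t * t + w b * w b" by (simp add: power2_eq_square algebra_simps)
      then show "\<bar>w b\<bar> \<le> t / 2 + (w b * w b) * (1 / (2 * t))" using t(1) by (simp add: field_simps)
    qed
    also have "\<dots> = t / 2 + ?E (\<lambda>b. w b * w b) * (1 / (2 * t))"
      by (simp add: int)
    also have "\<dots> \<le> t / 2 + (t * t) * (1 / (2 * t))"
      using var t(1) by (intro add_left_mono mult_right_mono) auto
    also have "\<dots> = t" using t(1) by (simp add: field_simps)
    finally show ?thesis .
  qed
  have le_abs: "?E (\<lambda>b. w b * g b) \<le> t" if "\<And>b. \<bar>g b\<bar> \<le> 1" for g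
  proof -
    have "?E (\<lambda>b. w b * g b) \<le> ?E (\<lambda>b. \<bar>w b\<bar>)"
    proof (rule integral_mono[OF int int])
      fix b
      have "w b * g b \<le> \<bar>w b\<bar> * \<bar>g b\<bar>" by (metis abs_ge_self abs_mult)
      also have "\<dots> \<le> \<bar>w b\<bar> * 1" using that by (intro mult_left_mono) auto
      finally show "w b * g b \<le> \<bar>w b\<bar>" by simp
    qed
    with abs show ?thesis by simp
  qed
  have pivot: "(1 - p) * ?E (\<lambda>b. of_bool (b i) * f b) \<le> ?E (\<lambda>b. (of_bool (b i) - p) * u b)" if i: "i \<in> P" for i
  proof -
    have iA: "i \<in> A" using i P(1) by auto
    have "?E (\<lambda>b. f (b(i := True))) \<le> ?E (\<lambda>b. u (b(i := True)) - u (b(i := False)))"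
    proof (rule integral_mono[OF int int])
      fix b
      show "f (b(i := True)) \<le> u (b(i := True)) - u (b(i := False))"
        using s_upd[OF iA, of b] P(2)[OF i] by (auto simp: f_def u_def)
    qed
    then have "p * (1 - p) * ?E (\<lambda>b. f (b(i := True)))
        \<le> p * (1 - p) * ?E (\<lambda>b. u (b(i := True)) - u (b(i := False)))"
      using p by (intro mult_left_mono) auto
    then show ?thesis
      unfolding expectation_bits_covariance[OF A iA p01] expectation_bits_times_bit(1)[OF A iA p01]
      by (simp add: mult_ac)
  qed
  have "(\<Sum>i\<in>P. of_bool (b i)) = w b + m * p" for b
    by (simp add: w_def sum_subtractf m_def)
  then have "(w b + m * p) * f b = (\<Sum>i\<in>P. of_bool (b i) * f b)" for b
    by (metis sum_distrib_right)
  then have count: "(\<Sum>i\<in>P. ?E (\<lambda>b. of_bool (b i) * f b)) = ?E (\<lambda>b. (w b + m * p) * f b)"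
    by (simp add: int)
  also have "\<dots> = ?E (\<lambda>b. w b * f b) + m * p * ?E f"
    by (simp add: distrib_right int)
  finally have count: "(\<Sum>i\<in>P. ?E (\<lambda>b. of_bool (b i) * f b)) = ?E (\<lambda>b. w b * f b) + m * p * ?E f" .
  have "(1 - p) * (\<Sum>i\<in>P. ?E (\<lambda>b. of_bool (b i) * f b)) \<le> ?E (\<lambda>b. w b * u b)"
    unfolding E_w sum_distrib_left by (intro sum_mono pivot)
  also have "\<dots> \<le> t" by (rule le_abs) (simp add: u_def)
  finally have le_t: "(1 - p) * (\<Sum>i\<in>P. ?E (\<lambda>b. of_bool (b i) * f b)) \<le> t" .
  have "?E (\<lambda>b. w b * (- f b)) \<le> t" by (rule le_abs) (simp add: f_def)
  then have neg: "- ?E (\<lambda>b. w b * f b) \<le> t" by (simp add: int)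
  have Ef: "?E f = measure_pmf.prob (bits A p) {b. s b = a}"
    unfolding f_def by (simp add: of_bool_def flip: indicator_def[of "{b. s b = a}", simplified])
  have "(1 - p) * (m * p * ?E f - t) \<le> (1 - p) * (?E (\<lambda>b. w b * f b) + m * p * ?E f)"
    using neg p by (intro mult_left_mono) auto
  also have "\<dots> \<le> t" using le_t count by simp
  finally have le: "(1 - p) * (m * p * ?E f - t) \<le> t" .
  have "m * p * ?E f - t \<le> 2 * t"
  proof (cases "m * p * ?E f - t \<le> 0")
    case False
    then have "1/2 * (m * p * ?E f - t) \<le> (1 - p) * (m * p * ?E f - t)"
      using p by (intro mult_right_mono) auto
    with le show ?thesis by simp
  qed (use t in simp)
  then have "t * t * ?E f \<le> 3 * t" using t by simp
  then have "t * ?E f \<le> 3" using t(1) by (metis mult.assoc mult.commute mult_le_cancel_left_pos)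
  then have "?E f \<le> 3 / t" using t(1) by (simp add: field_simps)
  then show ?thesis unfolding Ef by (simp add: s_def t_def m_def)
qed

text \<open>At least half of the nonzero coefficients have the same sign.\<close>

lemma littlewood_offord:
  fixes x :: "'i \<Rightarrow> real" and p a :: real
  assumes A: "finite A" and p: "0 < p" "p \<le> 1/2" and ne: "{i\<in>A. x i \<noteq> 0} \<noteq> {}"
  shows "measure_pmf.prob (bits A p) {b. (\<Sum>i\<in>A. of_bool (b i) * x i) = a}
    \<le> 3 / sqrt (card {i\<in>A. x i \<noteq> 0} * p / 2)"
proof -
  define P where "P = {i\<in>A. x i > 0}"
  define Q where "Q = {i\<in>A. x i < 0}"
  define k where "k = card {i\<in>A. x i \<noteq> 0}"
  have "{i\<in>A. x i \<noteq> 0} = P \<union> Q" by (auto simp: P_def Q_def)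
  then have "k = card P + card Q"
    unfolding k_def using A by (simp add: P_def Q_def card_Un_disjoint disjoint_iff)
  then have half: "2 * card P \<ge> k \<or> 2 * card Q \<ge> k" by linarith
  have k: "k > 0" using ne A by (simp add: k_def card_gt_0_iff)
  have bound: "3 / sqrt (c * p) \<le> 3 / sqrt (k * p / 2)" if "2 * c \<ge> k" for c
  proof (rule divide_left_mono)
    show "sqrt (k * p / 2) \<le> sqrt (c * p)" using that p by (auto simp: field_simps of_nat_mono)
    have "c > 0" using that k by simp
    then show "0 < sqrt (c * p) * sqrt (k * p / 2)" using p k by simp
  qed simp
  from half show ?thesis
  proof
    assume c: "2 * card P \<ge> k"
    then have "P \<noteq> {}" using k by auto
    then have "measure_pmf.prob (bits A p) {b. (\<Sum>i\<in>A. of_bool (b i) * x i) = a} \<le> 3 / sqrt (card P * p)"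
      by (intro littlewood_offord_positive A p) (auto simp: P_def)
    with bound[OF c] show ?thesis by (simp add: k_def)
  next
    assume c: "2 * card Q \<ge> k"
    then have "Q \<noteq> {}" using k by auto
    then have "measure_pmf.prob (bits A p) {b. (\<Sum>i\<in>A. of_bool (b i) * (- x i)) = - a} \<le> 3 / sqrt (card Q * p)"
      by (intro littlewood_offord_positive A p) (auto simp: Q_def)
    with bound[OF c] show ?thesis by (simp add: k_def sum_negf)
  qed
qed

section \<open>Random matrices with independent rows\<close>

definition rand_mat :: "nat \<Rightarrow> real \<Rightarrow> (nat \<Rightarrow> nat \<Rightarrow> bool) pmf" where
  "rand_mat n p = Pi_pmf {..<n} (\<lambda>_. False) (\<lambda>_. bits {..<n} p)"

lemma pmf_rand_mat:
  "pmf (rand_mat n p) b = (if \<forall>i j. \<not> (i < n \<and> j < n) \<longrightarrow> \<not> b i j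
     then \<Prod>i<n. \<Prod>j<n. pmf (bernoulli_pmf p) (b i j) else 0)"
proof (cases "\<forall>i j. \<not> (i < n \<and> j < n) \<longrightarrow> \<not> b i j")
  case True
  then have "\<forall>i. i \<notin> {..<n} \<longrightarrow> b i = (\<lambda>_. False)" "\<forall>i. \<forall>j. j \<notin> {..<n} \<longrightarrow> b i j = False"
    by auto
  then show ?thesis unfolding rand_mat_def using True by (simp add: pmf_Pi)
next
  case False
  then obtain i j where ij: "b i j" "\<not> (i < n \<and> j < n)" by auto
  show ?thesis
  proof (cases "i < n")
    case True
    with ij have "(\<Prod>i<n. pmf (bits {..<n} p) (b i)) = 0"
      by (intro prod_zero) (auto simp: pmf_Pi intro!: bexI[of _ i])
    then have "pmf (rand_mat n p) b = 0"
      unfolding rand_mat_def by (simp add: pmf_Pi[of "{..<n}" "\<lambda>_. False"])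
    with ij show ?thesis by auto
  next
    case False
    with ij have "i \<notin> {..<n} \<and> b i \<noteq> (\<lambda>_. False)" by auto
    then have "pmf (rand_mat n p) b = 0" unfolding rand_mat_def
      by (intro pmf_Pi_outside) auto
    with ij show ?thesis by auto
  qed
qed

text \<open>This symmetry transfers every estimate for columns to rows.\<close>

lemma rand_mat_transpose: "map_pmf (\<lambda>b j i. b i j) (rand_mat n p) = rand_mat n p"
proof (rule pmf_eqI)
  fix b :: "nat \<Rightarrow> nat \<Rightarrow> bool"
  have inj: "inj (\<lambda>(b :: nat \<Rightarrow> nat \<Rightarrow> bool) j i. b i j)"
    by (rule injI) (auto simp: fun_eq_iff)
  have "pmf (map_pmf (\<lambda>b j i. b i j) (rand_mat n p)) b = pmf (rand_mat n p) (\<lambda>j i. b i j)"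
    using pmf_map_inj'[OF inj, of "rand_mat n p" "\<lambda>j i. b i j"] by simp
  also have "\<dots> = pmf (rand_mat n p) b"
    unfolding pmf_rand_mat by (subst prod.swap) auto
  finally show "pmf (map_pmf (\<lambda>b j i. b i j) (rand_mat n p)) b = pmf (rand_mat n p) b" .
qed

lemma bits_pairs_eq_rand_mat:
  "bits ({..<n} \<times> {..<n}) p = map_pmf case_prod (rand_mat n p)"
proof (rule pmf_eqI)
  fix g :: "nat \<times> nat \<Rightarrow> bool"
  have inj: "inj (case_prod :: (nat \<Rightarrow> nat \<Rightarrow> bool) \<Rightarrow> _)"
    by (rule injI) (auto simp: fun_eq_iff)
  have "pmf (map_pmf case_prod (rand_mat n p)) g = pmf (rand_mat n p) (curry g)"
    using pmf_map_inj'[OF inj, of "rand_mat n p" "curry g"] by (simp add: case_prod_curry)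
  also have "\<dots> = pmf (bits ({..<n} \<times> {..<n}) p) g"
    unfolding pmf_rand_mat by (auto simp: pmf_Pi prod.cartesian_product)
  finally show "pmf (bits ({..<n} \<times> {..<n}) p) g = pmf (map_pmf case_prod (rand_mat n p)) g" by simp
qed

lemma prob_rows:
  "measure_pmf.prob (rand_mat n p) {b. \<forall>i<n. Q i (b i)} =
     (\<Prod>i<n. measure_pmf.prob (bits {..<n} p) {r. Q i r})"
proof -
  have "{b. \<forall>i<n. Q i (b i)} = Pi {..<n} (\<lambda>i. {r. Q i r})" by auto
  then show ?thesis unfolding rand_mat_def by (simp add: measure_Pi_pmf_Pi)
qed

lemma prob_union_bound:
  assumes "finite I" "E \<subseteq> (\<Union>i\<in>I. F i)" "\<And>i. i \<in> I \<Longrightarrow> measure_pmf.prob M (F i) \<le> c i"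
  shows "measure_pmf.prob M E \<le> (\<Sum>i\<in>I. c i)"
proof -
  have "measure_pmf.prob M E \<le> measure_pmf.prob M (\<Union>i\<in>I. F i)"
    using assms(2) by (intro measure_pmf.finite_measure_mono) auto
  also have "\<dots> \<le> (\<Sum>i\<in>I. measure_pmf.prob M (F i))"
    using assms(1) by (intro measure_pmf.finite_measure_subadditive_finite) auto
  also have "\<dots> \<le> (\<Sum>i\<in>I. c i)" using assms(3) by (rule sum_mono)
  finally show ?thesis .
qed

lemma prob_pair_le:
  assumes "\<And>f. measure_pmf.prob N {g. (f, g) \<in> X} \<le> c"
  shows "measure_pmf.prob (pair_pmf M N) X \<le> c"
proof -
  have c: "0 \<le> c" using assms measure_nonneg order_trans by blast
  have "emeasure (measure_pmf (pair_pmf M N)) X = (\<integral>\<^sup>+ f. \<integral>\<^sup>+ g. indicator X (f, g) \<partial>N \<partial>M)"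
    by (subst nn_integral_pair_pmf'[symmetric]) (simp add: nn_integral_indicator)
  also have "\<dots> \<le> (\<integral>\<^sup>+ f. ennreal c \<partial>M)"
  proof (rule nn_integral_mono)
    fix f
    have "(\<integral>\<^sup>+ g. indicator X (f, g) \<partial>N) = (\<integral>\<^sup>+ g. indicator {g. (f, g) \<in> X} g \<partial>N)"
      by (intro nn_integral_cong) (auto simp: indicator_def)
    also have "\<dots> = emeasure N {g. (f, g) \<in> X}" by simp
    also have "\<dots> \<le> ennreal c"
      using assms[of f] by (simp add: measure_pmf.emeasure_eq_measure ennreal_leI)
    finally show "(\<integral>\<^sup>+ g. indicator X (f, g) \<partial>N) \<le> ennreal c" .
  qed
  also have "\<dots> = ennreal c" by simp
  finally show ?thesis using c by (simp add: measure_pmf.emeasure_eq_measure)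
qed

text \<open>Expose the rows in \<open>T\<close> first. They determine the vector \<open>X b\<close>, and each of the remaining rows is
orthogonal to it with probability at most \<open>q\<close>, independently.\<close>

lemma prob_rows_orthogonal:
  assumes T: "T \<subseteq> {..<n}"
    and X: "\<And>b b'. (\<And>i. i \<in> T \<Longrightarrow> b i = b' i) \<Longrightarrow> X b = X b'"
    and q: "\<And>x. P x \<Longrightarrow> measure_pmf.prob (bits {..<n} p) {r. (\<Sum>j<n. of_bool (r j) * x j) = 0} \<le> q"
    and "0 \<le> q"
  shows "measure_pmf.prob (rand_mat n p)
      {b. P (X b) \<and> (\<forall>i\<in>{..<n} - T. (\<Sum>j<n. of_bool (b i j) * X b j) = (0::real))} \<le> q ^ (n - card T)"
proof -
  define T' where "T' = {..<n} - T"
  have fin: "finite T" "finite T'" using T finite_subset by (auto simp: T'_def)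
  let ?E = "{b. P (X b) \<and> (\<forall>i\<in>T'. (\<Sum>j<n. of_bool (b i j) * X b j) = (0::real))}"
  let ?M = "\<lambda>T. Pi_pmf T (\<lambda>_. False) (\<lambda>_. bits {..<n} p)"
  let ?merge = "\<lambda>(f, g) i. if i \<in> T then f i else g i :: nat \<Rightarrow> bool"
  have "{..<n} = T \<union> T'" "T \<inter> T' = {}" using T by (auto simp: T'_def)
  then have "rand_mat n p = map_pmf ?merge (pair_pmf (?M T) (?M T'))"
    unfolding rand_mat_def using Pi_pmf_union[OF fin, of "\<lambda>_. False" "\<lambda>_. bits {..<n} p"] by simp
  then have "measure_pmf.prob (rand_mat n p) ?E
      = measure_pmf.prob (pair_pmf (?M T) (?M T')) (?merge -` ?E)" by simp
  also have "\<dots> \<le> q ^ card T'"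
  proof (rule prob_pair_le)
    fix f
    have Xf: "X (?merge (f, g)) = X f" for g by (rule X) simp
    show "measure_pmf.prob (?M T') {g. (f, g) \<in> ?merge -` ?E} \<le> q ^ card T'"
    proof (cases "P (X f)")
      case True
      have "{g. (f, g) \<in> ?merge -` ?E} = Pi T' (\<lambda>_. {r. (\<Sum>j<n. of_bool (r j) * X f j) = 0})"
        using True Xf by (auto simp: T'_def)
      then have "measure_pmf.prob (?M T') {g. (f, g) \<in> ?merge -` ?E} =
          (\<Prod>i\<in>T'. measure_pmf.prob (bits {..<n} p) {r. (\<Sum>j<n. of_bool (r j) * X f j) = 0})"
        using fin by (simp only: measure_Pi_pmf_Pi)
      also have "\<dots> \<le> (\<Prod>i\<in>T'. q)" using q[OF True] by (intro prod_mono) auto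
      finally show ?thesis by simp
    next
      case False
      then have "{g. (f, g) \<in> ?merge -` ?E} = {}" using Xf by auto
      then have "measure_pmf.prob (?M T') {g. (f, g) \<in> ?merge -` ?E} = 0"
        by (simp only: measure_empty)
      then show ?thesis using \<open>0 \<le> q\<close> by simp
    qed
  qed
  also have "card T' = n - card T" using T fin by (simp add: T'_def card_Diff_subset)
  finally show ?thesis by (simp add: T'_def)
qed

lemma prob_bits_pattern:
  fixes p :: real
  assumes "finite A" "S \<subseteq> A" "S' \<subseteq> A" "S \<inter> S' = {}" "0 \<le> p" "p \<le> 1"
  shows "measure_pmf.prob (bits A p) {r. (\<forall>j\<in>S. r j) \<and> (\<forall>j\<in>S'. \<not> r j)} = p ^ card S * (1 - p) ^ card S'"
proof -
  have fin: "finite S" "finite S'" using assms(1-3) finite_subset by metis+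
  have "{r. (\<forall>j\<in>S. r j) \<and> (\<forall>j\<in>S'. \<not> r j)} =
      Pi A (\<lambda>j. if j \<in> S then {True} else if j \<in> S' then {False} else UNIV)"
    using assms by (fastforce split: if_splits)
  then have "measure_pmf.prob (bits A p) {r. (\<forall>j\<in>S. r j) \<and> (\<forall>j\<in>S'. \<not> r j)} =
      (\<Prod>j\<in>A. measure_pmf.prob (bernoulli_pmf p) (if j \<in> S then {True} else if j \<in> S' then {False} else UNIV))"
    using assms(1) by (simp only: measure_Pi_pmf_Pi)
  also have "\<dots> = (\<Prod>j\<in>A. (if j \<in> S then p else 1) * (if j \<in> S' then 1 - p else 1))"
    using assms by (intro prod.cong) (auto simp: measure_pmf_single)
  also have "\<dots> = p ^ card S * (1 - p) ^ card S'"
    using assms by (simp add: prod.distrib prod.If_cases Int_absorb1)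
  finally show ?thesis .
qed

lemma prob_many_ones_le:
  fixes p :: real
  assumes "finite A" "S \<subseteq> A" and p: "0 \<le> p" "p \<le> 1"
  shows "measure_pmf.prob (bits A p) {r. l \<le> card {j\<in>S. r j}} \<le> (card S * p) ^ l"
proof -
  have finS: "finite S" using assms finite_subset by auto
  have "measure_pmf.prob (bits A p) {r. l \<le> card {j\<in>S. r j}} \<le> (\<Sum>T\<in>{T. T \<subseteq> S \<and> card T = l}. p ^ l)"
  proof (rule prob_union_bound)
    show "{r. l \<le> card {j\<in>S. r j}} \<subseteq> (\<Union>T\<in>{T. T \<subseteq> S \<and> card T = l}. {r. (\<forall>j\<in>T. r j) \<and> (\<forall>j\<in>{}. \<not> r j)})"
    proof
      fix r assume "r \<in> {r. l \<le> card {j\<in>S. r j}}"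
      then have "l \<le> card {j\<in>S. r j}" by simp
      from obtain_subset_with_card_n[OF this] obtain T where "T \<subseteq> {j\<in>S. r j}" "card T = l" by metis
      then show "r \<in> (\<Union>T\<in>{T. T \<subseteq> S \<and> card T = l}. {r. (\<forall>j\<in>T. r j) \<and> (\<forall>j\<in>{}. \<not> r j)})" by auto
    qed
    fix T assume T: "T \<in> {T. T \<subseteq> S \<and> card T = l}"
    then show "measure_pmf.prob (bits A p) {r. (\<forall>j\<in>T. r j) \<and> (\<forall>j\<in>{}. \<not> r j)} \<le> p ^ l"
      using assms by (subst prob_bits_pattern) auto
  qed (use finS in auto)
  also have "\<dots> = (card S choose l) * p ^ l" using n_subsets[OF finS] by simp
  also have "\<dots> \<le> real (card S) ^ l * p ^ l"
  proof (rule mult_right_mono)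
    show "real (card S choose l) \<le> real (card S) ^ l"
      by (cases "l \<le> card S") (simp_all add: binomial_le_pow binomial_eq_0 not_le flip: of_nat_power)
  qed (use p in simp)
  finally show ?thesis by (simp add: power_mult_distrib)
qed

lemma prob_not_one_le:
  fixes p :: real
  assumes "finite A" "S \<subseteq> A" and p: "0 \<le> p" "p \<le> 1"
  shows "measure_pmf.prob (bits A p) {r. card {j\<in>S. r j} \<noteq> 1} \<le> exp (- (card S * p * (1 - p) ^ (card S - 1)))"
proof -
  have finS: "finite S" using assms finite_subset by auto
  define F where "F j = {r. (\<forall>i\<in>{j}. r i) \<and> (\<forall>i\<in>S - {j}. \<not> r i)}" for j
  have "(\<Sum>j\<in>S. p * (1 - p) ^ (card S - 1)) = (\<Sum>j\<in>S. measure_pmf.prob (bits A p) (F j))"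
  proof (rule sum.cong)
    fix j assume "j \<in> S"
    then show "p * (1 - p) ^ (card S - 1) = measure_pmf.prob (bits A p) (F j)"
      unfolding F_def using assms finS by (subst prob_bits_pattern) auto
  qed simp
  also have "\<dots> = measure_pmf.prob (bits A p) (\<Union>j\<in>S. F j)"
    using finS by (intro measure_pmf.finite_measure_finite_Union[symmetric])
      (auto simp: disjoint_family_on_def F_def)
  also have "(\<Union>j\<in>S. F j) \<subseteq> {r. card {j\<in>S. r j} = 1}"
  proof
    fix r assume "r \<in> (\<Union>j\<in>S. F j)"
    then obtain j where "j \<in> S" "r \<in> F j" by auto
    then have "{j\<in>S. r j} = {j}" by (auto simp: F_def)
    then show "r \<in> {r. card {j\<in>S. r j} = 1}" by simp
  qed
  then have "measure_pmf.prob (bits A p) (\<Union>j\<in>S. F j) \<le> measure_pmf.prob (bits A p) {r. card {j\<in>S. r j} = 1}"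
    by (intro measure_pmf.finite_measure_mono) auto
  finally have "card S * p * (1 - p) ^ (card S - 1) \<le> measure_pmf.prob (bits A p) {r. card {j\<in>S. r j} = 1}"
    by simp
  moreover have "{r. card {j\<in>S. r j} \<noteq> 1} = space (measure_pmf (bits A p)) - {r. card {j\<in>S. r j} = 1}" by auto
  then have "measure_pmf.prob (bits A p) {r. card {j\<in>S. r j} \<noteq> 1}
      = 1 - measure_pmf.prob (bits A p) {r. card {j\<in>S. r j} = 1}"
    by (simp only: measure_pmf.prob_compl[of _ "bits A p"] sets_measure_pmf UNIV_I)
  moreover have "1 - z \<le> exp (- z)" for z :: real using exp_ge_add_one_self[of "- z"] by simp
  ultimately show ?thesis
    by (smt (verit))
qed

section \<open>Null vectors of small support\<close>

text \<open>The ratio of the geometric series that bounds the expected number of sets \<open>S\<close> with \<open>surplus\<close>, as a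
function of the mean degree \<open>d = n p\<close>. For \<open>card S * p \<le> 72\<close> a given row
meets \<open>S\<close> exactly once with probability at least \<open>exp (- 144) * card S * p\<close>; the factor
\<open>1/2\<close> is the proportion of rows that is certainly available.\<close>

definition sparse_rate :: "real \<Rightarrow> real" where
  "sparse_rate d = 2 * exp 2 * d ^ 2 * exp (- (exp (- 144) / 2 * d))"

lemma power_div_fact_le_exp: "real k ^ k / fact k \<le> exp (real k)"
proof -
  have "(\<Sum>i\<in>{k}. inverse (fact i) *\<^sub>R real k ^ i) \<le> (\<Sum>i. inverse (fact i) *\<^sub>R real k ^ i)"
    by (rule sum_le_suminf[OF summable_exp_generic]) auto
  then show ?thesis by (simp add: exp_def divide_inverse mult.commute)
qed

lemma binomial_le_pow_div_fact: "real (n choose k) \<le> real n ^ k / fact k"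
proof -
  have "real ((n choose k) * fact k) \<le> real (n ^ k)"
    using binomial_fact_pow[of n k] of_nat_le_iff by blast
  then show ?thesis by (simp add: field_simps)
qed

text \<open>Union bound over the rows required by \<open>surplus\<close>: a row meets \<open>S\<close> at least \<open>m\<close> times with probability
at most \<open>(k p)\<^sup>m\<close>, and \<open>r\<close> bounds the probability that it does not meet \<open>S\<close> exactly once.\<close>

lemma prob_surplus_le:
  fixes p :: real
  assumes S: "S \<subseteq> {..<n}" "card S = k" "0 < k" and p: "0 \<le> p" "p \<le> 1"
  defines "r \<equiv> exp (- (k * p * (1 - p) ^ (k - 1)))"
  shows "measure_pmf.prob (rand_mat n p) {b. surplus n b S}
    \<le> (real (n choose k) * (k * p) ^ (2 * k)
        + real (n choose (k - 1)) * k * (k * p) ^ (2 * k - 1)) * r ^ (n - k)"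
proof -
  let ?deg = "\<lambda>r. card {j\<in>S. r j}"
  have r: "0 \<le> r" "r \<le> 1" using p by (simp_all add: r_def)
  have kp: "0 \<le> real k * p" using p by simp
  define F where "F T i0 = {b. \<forall>i<n. (if i = i0 then 3 \<le> ?deg (b i) else
      if i \<in> T then 2 \<le> ?deg (b i) else ?deg (b i) \<noteq> 1)}" for T i0
  have prob_F: "measure_pmf.prob (rand_mat n p) (F T i0)
      \<le> (\<Prod>i<n. if i = i0 then (k * p) ^ 3 else if i \<in> T then (k * p)\<^sup>2 else r)" for T i0
  proof -
    have "measure_pmf.prob (rand_mat n p) (F T i0) = (\<Prod>i<n. measure_pmf.prob (bits {..<n} p)
         {r. if i = i0 then 3 \<le> ?deg r else if i \<in> T then 2 \<le> ?deg r else ?deg r \<noteq> 1})"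
      unfolding F_def by (rule prob_rows[where Q = "\<lambda>i r. if i = i0 then 3 \<le> ?deg r else
        if i \<in> T then 2 \<le> ?deg r else ?deg r \<noteq> 1"])
    also have "\<dots> \<le> (\<Prod>i<n. if i = i0 then (k * p) ^ 3 else if i \<in> T then (k * p)\<^sup>2 else r)"
    proof (rule prod_mono, intro conjI)
      fix i
      have "measure_pmf.prob (bits {..<n} p) {r. ?deg r \<noteq> 1} \<le> r"
        using prob_not_one_le[OF finite_lessThan S(1) p] S(2) by (simp add: r_def)
      moreover have "measure_pmf.prob (bits {..<n} p) {r. m \<le> ?deg r} \<le> (k * p) ^ m" for m
        using prob_many_ones_le[OF finite_lessThan S(1) p, of m] S(2) by simp
      ultimately show "measure_pmf.prob (bits {..<n} p)
           {r. if i = i0 then 3 \<le> ?deg r else if i \<in> T then 2 \<le> ?deg r else ?deg r \<noteq> 1}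
          \<le> (if i = i0 then (k * p) ^ 3 else if i \<in> T then (k * p)\<^sup>2 else r)"
        by simp
    qed simp
    finally show ?thesis .
  qed
  define T1 where "T1 = {T. T \<subseteq> {..<n} \<and> card T = k}"
  define T2 where "T2 = (SIGMA T:{T. T \<subseteq> {..<n} \<and> card T = k - 1}. T)"
  have fin: "finite {T. T \<subseteq> {..<n} \<and> card T = m}" for m
    by (rule finite_subset[of _ "Pow {..<n}"]) auto
  have fin_sub: "finite T" if "T \<subseteq> {..<n}" for T using that finite_subset by blast
  have fin12: "finite T1" "finite T2"
    unfolding T1_def T2_def using fin fin_sub by (auto intro!: finite_SigmaI)
  \<comment> \<open>Row index \<open>n\<close> does not exist, so \<open>F T n\<close> asks for no row of degree three.\<close>
  have "measure_pmf.prob (rand_mat n p) (\<Union>T\<in>T1. F T n) \<le> (\<Sum>T\<in>T1. (k * p) ^ (2 * k) * r ^ (n - k))"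
  proof (rule prob_union_bound[OF fin12(1) order_refl])
    fix T assume T: "T \<in> T1"
    have "measure_pmf.prob (rand_mat n p) (F T n) \<le> (\<Prod>i<n. if i \<in> T then (k * p)\<^sup>2 else r)"
      using prob_F[of T n] by (simp cong: prod.cong_simp)
    also have "\<dots> = ((k * p)\<^sup>2) ^ card T * r ^ card ({..<n} - T)"
      using T by (simp add: prod.If_cases Int_absorb1 T1_def Diff_eq)
    also have "\<dots> = (k * p) ^ (2 * k) * r ^ (n - k)"
      using T fin_sub by (simp add: T1_def card_Diff_subset power_mult)
    finally show "measure_pmf.prob (rand_mat n p) (F T n) \<le> (k * p) ^ (2 * k) * r ^ (n - k)" .
  qed
  also have "\<dots> = real (n choose k) * (k * p) ^ (2 * k) * r ^ (n - k)"
    using n_subsets[of "{..<n}" k] by (simp add: T1_def)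
  finally have bound1: "measure_pmf.prob (rand_mat n p) (\<Union>T\<in>T1. F T n)
      \<le> real (n choose k) * (k * p) ^ (2 * k) * r ^ (n - k)" .
  have "measure_pmf.prob (rand_mat n p) (\<Union>(T, i0)\<in>T2. F T i0)
      \<le> (\<Sum>(T, i0)\<in>T2. (k * p) ^ (2 * k - 1) * r ^ (n - k))"
  proof (rule prob_union_bound[OF fin12(2) order_refl])
    fix Ti assume Ti: "Ti \<in> T2"
    obtain T i0 where eq: "Ti = (T, i0)" by (cases Ti)
    have T: "T \<subseteq> {..<n}" "card T = k - 1" "i0 \<in> T" using Ti eq by (auto simp: T2_def)
    have k2: "k \<ge> 2" using T fin_sub[OF T(1)] by (cases "card T") auto
    have "measure_pmf.prob (rand_mat n p) (F T i0)
        \<le> (\<Prod>i<n. if i = i0 then (k * p) ^ 3 else if i \<in> T then (k * p)\<^sup>2 else r)" by (rule prob_F)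
    also have "\<dots> = (k * p) ^ 3 * (\<Prod>i\<in>{..<n} - {i0}. if i \<in> T then (k * p)\<^sup>2 else r)"
      using T by (subst prod.remove[of _ i0]) auto
    also have "(\<Prod>i\<in>{..<n} - {i0}. if i \<in> T then (k * p)\<^sup>2 else r)
        = ((k * p)\<^sup>2) ^ card (T - {i0}) * r ^ card ({..<n} - T)"
    proof -
      have "({..<n} - {i0}) \<inter> {i. i \<in> T} = T - {i0}" "({..<n} - {i0}) \<inter> - {i. i \<in> T} = {..<n} - T"
        using T by auto
      then show ?thesis by (simp add: prod.If_cases)
    qed
    also have "(k * p) ^ 3 * (((k * p)\<^sup>2) ^ card (T - {i0}) * r ^ card ({..<n} - T))
        = (k * p) ^ (3 + 2 * (k - 2)) * r ^ (n - (k - 1))"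
    proof -
      have "card (T - {i0}) = k - 2" "card ({..<n} - T) = n - (k - 1)"
        using T fin_sub[OF T(1)] by (simp_all add: card_Diff_subset)
      then show ?thesis by (simp add: power_mult[symmetric] power_add)
    qed
    also have "3 + 2 * (k - 2) = 2 * k - 1" using k2 by simp
    also have "(k * p) ^ (2 * k - 1) * r ^ (n - (k - 1)) \<le> (k * p) ^ (2 * k - 1) * r ^ (n - k)"
      using r kp by (intro mult_left_mono power_decreasing) auto
    finally show "measure_pmf.prob (rand_mat n p) (case Ti of (T, i0) \<Rightarrow> F T i0)
        \<le> (case Ti of (T, i0) \<Rightarrow> (k * p) ^ (2 * k - 1) * r ^ (n - k))"
      by (simp add: eq)
  qed
  also have "\<dots> = card T2 * ((k * p) ^ (2 * k - 1) * r ^ (n - k))" by simp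
  also have "card T2 = (n choose (k - 1)) * (k - 1)"
  proof -
    have "card T2 = (\<Sum>T\<in>{T. T \<subseteq> {..<n} \<and> card T = k - 1}. card T)"
      unfolding T2_def using fin fin_sub by (subst card_SigmaI) auto
    also have "\<dots> = (n choose (k - 1)) * (k - 1)" using n_subsets[of "{..<n}" "k - 1"] by simp
    finally show ?thesis .
  qed
  also have "real ((n choose (k - 1)) * (k - 1)) * ((k * p) ^ (2 * k - 1) * r ^ (n - k))
      \<le> (real (n choose (k - 1)) * k) * ((k * p) ^ (2 * k - 1) * r ^ (n - k))"
    using kp r by (intro mult_right_mono) (auto intro!: mult_left_mono)
  finally have bound2: "measure_pmf.prob (rand_mat n p) (\<Union>(T, i0)\<in>T2. F T i0)
      \<le> real (n choose (k - 1)) * k * (k * p) ^ (2 * k - 1) * r ^ (n - k)" by (simp add: mult_ac)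
  have "{b. surplus n b S} \<subseteq> (\<Union>T\<in>T1. F T n) \<union> (\<Union>(T, i0)\<in>T2. F T i0)"
  proof
    fix b assume "b \<in> {b. surplus n b S}"
    then have b: "\<forall>i<n. ?deg (b i) \<noteq> 1" and
      "(\<exists>T\<subseteq>{..<n}. card T = card S \<and> (\<forall>i\<in>T. 2 \<le> ?deg (b i))) \<or>
       (\<exists>T\<subseteq>{..<n}. Suc (card T) = card S \<and> (\<forall>i\<in>T. 2 \<le> ?deg (b i)) \<and> (\<exists>i\<in>T. 3 \<le> ?deg (b i)))"
      by (auto simp: surplus_def)
    from this(2) show "b \<in> (\<Union>T\<in>T1. F T n) \<union> (\<Union>(T, i0)\<in>T2. F T i0)"
    proof
      assume "\<exists>T\<subseteq>{..<n}. card T = card S \<and> (\<forall>i\<in>T. 2 \<le> ?deg (b i))"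
      then obtain T where "T \<subseteq> {..<n}" "card T = card S" "\<forall>i\<in>T. 2 \<le> ?deg (b i)" by auto
      then have "T \<in> T1" "b \<in> F T n" using b S by (auto simp: T1_def F_def)
      then show ?thesis by blast
    next
      assume "\<exists>T\<subseteq>{..<n}. Suc (card T) = card S \<and> (\<forall>i\<in>T. 2 \<le> ?deg (b i)) \<and> (\<exists>i\<in>T. 3 \<le> ?deg (b i))"
      then obtain T i0 where "T \<subseteq> {..<n}" "Suc (card T) = card S" "\<forall>i\<in>T. 2 \<le> ?deg (b i)"
        "i0 \<in> T" "3 \<le> ?deg (b i0)" by auto
      then have "(T, i0) \<in> T2" "b \<in> F T i0" using b S by (auto simp: T2_def F_def)
      then show ?thesis by blast
    qed
  qed
  then have "measure_pmf.prob (rand_mat n p) {b. surplus n b S}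
      \<le> measure_pmf.prob (rand_mat n p) ((\<Union>T\<in>T1. F T n) \<union> (\<Union>(T, i0)\<in>T2. F T i0))"
    by (intro measure_pmf.finite_measure_mono) auto
  also have "\<dots> \<le> measure_pmf.prob (rand_mat n p) (\<Union>T\<in>T1. F T n)
      + measure_pmf.prob (rand_mat n p) (\<Union>(T, i0)\<in>T2. F T i0)"
    by (rule measure_Un_le) auto
  also have "\<dots> \<le> real (n choose k) * (k * p) ^ (2 * k) * r ^ (n - k)
      + real (n choose (k - 1)) * k * (k * p) ^ (2 * k - 1) * r ^ (n - k)"
    using bound1 bound2 by (rule add_mono)
  finally show ?thesis by (simp add: distrib_right)
qed

text \<open>The binomial coefficients and powers of \<open>k\<close> combine to \<open>(k\<^sup>k / k!)\<^sup>2 \<le> exp (2 k)\<close>, which leaves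
\<open>d\<^bsup>2 k\<^esup>\<close> up to constants; the second summand is better by a factor \<open>d\<close>, which is given away, and
worse by a factor \<open>k \<le> 2\<^sup>k\<close>. The rows without a unique neighbour in \<open>S\<close> contribute \<open>exp (- c d k)\<close>.\<close>

lemma sparse_term_le:
  fixes p :: real
  assumes k: "0 < k" "k * p \<le> 72" and p: "0 < p" "p \<le> 1/2" and n: "144 \<le> n * p"
  shows "real (n choose k) * ((real (n choose k) * (k * p) ^ (2 * k)
        + real (n choose (k - 1)) * k * (k * p) ^ (2 * k - 1))
        * exp (- (k * p * (1 - p) ^ (k - 1))) ^ (n - k)) \<le> 2 * sparse_rate (n * p) ^ k"
proof -
  define d where "d = n * p"
  have d1: "1 \<le> d" using n by (simp add: d_def)
  have npos: "0 < n" using n by (cases n) auto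
  define K where "K = real k ^ k / fact k"
  have K: "0 \<le> K" "K \<le> exp (real k)" using power_div_fact_le_exp by (simp_all add: K_def)
  have KK: "K * K \<le> exp 2 ^ k"
  proof -
    have "K * K \<le> exp (real k) * exp (real k)" using K by (intro mult_mono) auto
    also have "\<dots> = exp 2 ^ k" by (simp add: exp_of_nat_mult[symmetric] exp_add[symmetric])
    finally show ?thesis .
  qed
  obtain l where l: "k = Suc l" using k(1) by (cases k) auto
  have "real (n choose k) * (real (n choose k) * (k * p) ^ (2 * k))
      \<le> (real n ^ k / fact k) * ((real n ^ k / fact k) * (k * p) ^ (2 * k))"
    using p by (intro mult_mono binomial_le_pow_div_fact) auto
  also have "\<dots> = d ^ (2 * k) * (K * K)"
    unfolding d_def K_def mult_2 power_add power_mult_distrib by (simp add: field_simps)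
  also have "\<dots> \<le> d ^ (2 * k) * exp 2 ^ k" using KK d1 by (intro mult_left_mono) auto
  also have "\<dots> \<le> d ^ (2 * k) * (2 * exp 2) ^ k"
    using d1 by (intro mult_left_mono power_mono) auto
  finally have first: "real (n choose k) * (real (n choose k) * (k * p) ^ (2 * k)) \<le> d ^ (2 * k) * (2 * exp 2) ^ k" .
  have "real (n choose k) * (real (n choose (k - 1)) * k * (k * p) ^ (2 * k - 1))
      \<le> (real n ^ k / fact k) * ((real n ^ (k - 1) / fact (k - 1)) * k * (k * p) ^ (2 * k - 1))"
    using p by (intro mult_mono binomial_le_pow_div_fact) auto
  also have "\<dots> = d ^ (2 * k - 1) * (K * K) * k"
  proof -
    have "2 * k - 1 = k + l" by (simp add: l)
    moreover have "fact k = real k * fact l" by (simp add: l)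
    moreover have "real k ^ k = real k * real k ^ l" by (simp add: l)
    ultimately show ?thesis
      using k(1) by (simp add: d_def K_def power_mult_distrib power_add l[symmetric] field_simps)
         (simp add: l field_simps)
  qed
  also have "\<dots> \<le> d ^ (2 * k) * exp 2 ^ k * 2 ^ k"
  proof (intro mult_mono)
    show "d ^ (2 * k - 1) \<le> d ^ (2 * k)" using d1 by (intro power_increasing) auto
    show "real k \<le> 2 ^ k" using less_exp[of k] by (metis less_imp_le of_nat_le_iff of_nat_numeral of_nat_power)
  qed (use KK K d1 in auto)
  also have "\<dots> = d ^ (2 * k) * (2 * exp 2) ^ k" by (simp add: power_mult_distrib)
  finally have second: "real (n choose k) * (real (n choose (k - 1)) * k * (k * p) ^ (2 * k - 1))
      \<le> d ^ (2 * k) * (2 * exp 2) ^ k" .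
  have decay: "exp (- (k * p * (1 - p) ^ (k - 1))) ^ (n - k) \<le> exp (- (exp (- 144) / 2 * d)) ^ k"
  proof -
    have "ln (1 - p) \<ge> - p - 2 * p\<^sup>2" using p by (intro ln_one_minus_pos_lower_bound) auto
    moreover have "2 * p\<^sup>2 \<le> p" using p by (simp add: power2_eq_square)
    ultimately have "ln (1 - p) \<ge> - 2 * p" by linarith
    then have "exp (- 2 * p) \<le> 1 - p" using p by (simp add: ln_ge_iff)
    then have "exp (- 2 * p) ^ (k - 1) \<le> (1 - p) ^ (k - 1)" by (intro power_mono) auto
    moreover have "exp (- 144) \<le> exp (- 2 * p) ^ (k - 1)"
    proof -
      have "real (k - 1) * p \<le> 72" using k p by (simp add: l distrib_right)
      then show ?thesis by (simp add: exp_of_nat_mult[symmetric] mult.commute)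
    qed
    ultimately have c: "exp (- 144) \<le> (1 - p) ^ (k - 1)" by linarith
    have "k * p \<le> n * p / 2" using k n by linarith
    then have "real k \<le> n / 2" using p by (simp add: field_simps)
    then have half: "n / 2 \<le> real (n - k)" by linarith
    have "real k * (exp (- 144) / 2 * d) = (n / 2) * (k * p * exp (- 144))" by (simp add: d_def)
    also have "\<dots> \<le> real (n - k) * (k * p * (1 - p) ^ (k - 1))"
      using half c p by (intro mult_mono) auto
    finally show ?thesis by (simp add: exp_of_nat_mult[symmetric])
  qed
  have "real (n choose k) * ((real (n choose k) * (k * p) ^ (2 * k)
        + real (n choose (k - 1)) * k * (k * p) ^ (2 * k - 1))
        * exp (- (k * p * (1 - p) ^ (k - 1))) ^ (n - k))
      = (real (n choose k) * (real (n choose k) * (k * p) ^ (2 * k))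
        + real (n choose k) * (real (n choose (k - 1)) * k * (k * p) ^ (2 * k - 1)))
        * exp (- (k * p * (1 - p) ^ (k - 1))) ^ (n - k)"
    by (simp add: algebra_simps)
  also have "\<dots> \<le> (2 * (d ^ (2 * k) * (2 * exp 2) ^ k)) * exp (- (exp (- 144) / 2 * d)) ^ k"
    using first second decay d1 by (intro mult_mono) auto
  also have "\<dots> = 2 * sparse_rate d ^ k"
    unfolding sparse_rate_def power_mult_distrib power_mult[of d 2 k] by (simp add: mult_ac)
  finally show ?thesis by (simp add: d_def)
qed

lemma prob_sparse_surplus_le:
  fixes p :: real
  assumes p: "0 < p" "p \<le> 1/2" and n: "144 \<le> n * p" and rate: "sparse_rate (n * p) \<le> 1/2"
  shows "measure_pmf.prob (rand_mat n p)
      {b. \<exists>S\<subseteq>{..<n}. S \<noteq> {} \<and> card S * p \<le> 72 \<and> surplus n b S} \<le> 4 * sparse_rate (n * p)"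
proof -
  define \<theta> where "\<theta> = sparse_rate (n * p)"
  have \<theta>: "0 \<le> \<theta>" "\<theta> \<le> 1/2" using rate by (simp_all add: \<theta>_def sparse_rate_def)
  define I where "I = {k. 0 < k \<and> k \<le> n \<and> k * p \<le> 72}"
  define sets where "sets k = {S. S \<subseteq> {..<n} \<and> card S = k}" for k
  have fin: "finite I" "finite (sets k)" for k
  proof -
    show "finite I" by (rule finite_subset[of _ "{..n}"]) (auto simp: I_def)
    show "finite (sets k)" by (rule finite_subset[of _ "Pow {..<n}"]) (auto simp: sets_def)
  qed
  have "measure_pmf.prob (rand_mat n p)
      {b. \<exists>S\<subseteq>{..<n}. S \<noteq> {} \<and> card S * p \<le> 72 \<and> surplus n b S} \<le> (\<Sum>k\<in>I. 2 * \<theta> ^ k)"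
  proof (rule prob_union_bound[OF fin(1)])
    show "{b. \<exists>S\<subseteq>{..<n}. S \<noteq> {} \<and> card S * p \<le> 72 \<and> surplus n b S}
        \<subseteq> (\<Union>k\<in>I. \<Union>S\<in>sets k. {b. surplus n b S})"
    proof
      fix b assume "b \<in> {b. \<exists>S\<subseteq>{..<n}. S \<noteq> {} \<and> card S * p \<le> 72 \<and> surplus n b S}"
      then obtain S where S: "S \<subseteq> {..<n}" "S \<noteq> {}" "card S * p \<le> 72" "surplus n b S" by auto
      have "finite S" using S(1) finite_subset by blast
      then have "card S \<in> I" using S card_mono[OF finite_lessThan S(1)] by (simp add: I_def card_gt_0_iff)
      moreover have "S \<in> sets (card S)" using S by (simp add: sets_def)
      ultimately show "b \<in> (\<Union>k\<in>I. \<Union>S\<in>sets k. {b. surplus n b S})" using S(4) by blast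
    qed
    fix k assume "k \<in> I"
    then have k: "0 < k" "k * p \<le> 72" by (auto simp: I_def)
    let ?c = "(real (n choose k) * (k * p) ^ (2 * k)
        + real (n choose (k - 1)) * k * (k * p) ^ (2 * k - 1))
        * exp (- (k * p * (1 - p) ^ (k - 1))) ^ (n - k)"
    have "measure_pmf.prob (rand_mat n p) (\<Union>S\<in>sets k. {b. surplus n b S}) \<le> (\<Sum>S\<in>sets k. ?c)"
    proof (rule prob_union_bound[OF fin(2) order_refl])
      fix S assume "S \<in> sets k"
      then show "measure_pmf.prob (rand_mat n p) {b. surplus n b S} \<le> ?c"
        using k p by (intro prob_surplus_le) (auto simp: sets_def)
    qed
    also have "\<dots> = real (n choose k) * ?c"
      using n_subsets[of "{..<n}" k] by (simp add: sets_def)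
    also have "\<dots> \<le> 2 * \<theta> ^ k" unfolding \<theta>_def by (rule sparse_term_le[OF k p n])
    finally show "measure_pmf.prob (rand_mat n p) (\<Union>S\<in>sets k. {b. surplus n b S}) \<le> 2 * \<theta> ^ k" .
  qed
  also have "\<dots> \<le> (\<Sum>k\<in>Suc ` {..<n}. 2 * \<theta> ^ k)"
  proof (rule sum_mono2)
    show "I \<subseteq> Suc ` {..<n}"
    proof
      fix k assume "k \<in> I"
      then show "k \<in> Suc ` {..<n}" by (intro image_eqI[of _ _ "k - 1"]) (auto simp: I_def)
    qed
  qed (use \<theta> in auto)
  also have "\<dots> = 2 * \<theta> * (\<Sum>k<n. \<theta> ^ k)"
    by (simp add: sum.reindex sum_distrib_left mult.assoc)
  also have "(\<Sum>k<n. \<theta> ^ k) \<le> 2"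
  proof -
    have "(\<Sum>k<n. \<theta> ^ k) \<le> (\<Sum>k. \<theta> ^ k)"
      using \<theta> by (intro sum_le_suminf summable_geometric) auto
    also have "\<dots> = 1 / (1 - \<theta>)" using \<theta> by (intro suminf_geometric) auto
    also have "\<dots> \<le> 2" using \<theta> by (simp add: field_simps)
    finally show ?thesis .
  qed
  then have "2 * \<theta> * (\<Sum>k<n. \<theta> ^ k) \<le> 2 * \<theta> * 2" using \<theta> by (intro mult_left_mono) auto
  finally show ?thesis by (simp add: \<theta>_def)
qed

section \<open>Null vectors of medium support\<close>

lemma binomial_le_geometric: "real (n choose k) \<le> 16 ^ k * (17/16) ^ n"
proof (cases "k \<le> n")
  case True
  have "real (n choose k) * (1/16) ^ k * 1 ^ (n - k) \<le> (\<Sum>j\<le>n. real (n choose j) * (1/16) ^ j * 1 ^ (n - j))"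
    using True by (intro member_le_sum) auto
  also have "\<dots> = (1/16 + 1) ^ n" by (rule binomial_ring[symmetric])
  finally show ?thesis by (simp add: power_divide field_simps)
qed (simp add: binomial_eq_0 not_le)

text \<open>\<open>36 k \<le> n\<close> keeps the entropy of the choice of \<open>k\<close> columns and \<open>k - 1\<close> rows below the factor
\<open>1/2\<close> gained from almost every row: \<open>512\<^sup>k \<le> (6/5)\<^sup>n\<close>, and \<open>6/5 * (17/16)\<^sup>2 / 2 < 17/25\<close>.\<close>

lemma medium_term_le:
  assumes "0 < k" "36 * k \<le> n"
  shows "real (n choose k) * (real (n choose (k - 1)) * (1/2) ^ (n - (k - 1))) \<le> (17/25) ^ n"
proof -
  have "real (n choose k) * (real (n choose (k - 1)) * (1/2) ^ (n - (k - 1)))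
      \<le> (16 ^ k * (17/16) ^ n) * ((16 ^ k * (17/16) ^ n) * (2 ^ k * (1/2) ^ n))"
  proof (intro mult_mono binomial_le_geometric)
    have "real (n choose (k - 1)) \<le> 16 ^ (k - 1) * (17/16) ^ n" by (rule binomial_le_geometric)
    also have "\<dots> \<le> 16 ^ k * (17/16) ^ n" by (intro mult_right_mono power_increasing) auto
    finally show "real (n choose (k - 1)) \<le> 16 ^ k * (17/16) ^ n" .
    have "2 ^ k * (1/2 :: real) ^ n = (1/2) ^ (n - k)"
      using assms by (simp add: power_divide power_diff)
    moreover have "(1/2 :: real) ^ (n - (k - 1)) \<le> (1/2) ^ (n - k)" by (rule power_decreasing) auto
    ultimately show "(1/2 :: real) ^ (n - (k - 1)) \<le> 2 ^ k * (1/2) ^ n" by simp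
  qed auto
  also have "\<dots> = 512 ^ k * (17/16 * (17/16) * (1/2)) ^ n"
  proof -
    have "(512 :: real) ^ k = 16 ^ k * 16 ^ k * 2 ^ k" by (simp flip: power_mult_distrib)
    then show ?thesis by (simp only: power_mult_distrib mult_ac)
  qed
  also have "\<dots> \<le> (6/5) ^ n * (17/16 * (17/16) * (1/2)) ^ n"
  proof (rule mult_right_mono)
    have "(512 :: real) ^ k \<le> ((6/5) ^ 36) ^ k" by (rule power_mono) (simp_all add: power_divide)
    also have "\<dots> = (6/5) ^ (36 * k)" by (simp only: power_mult)
    also have "\<dots> \<le> (6/5) ^ n" using assms(2) by (intro power_increasing) auto
    finally show "(512 :: real) ^ k \<le> (6/5) ^ n" .
  qed simp
  also have "\<dots> = (6/5 * (17/16 * (17/16) * (1/2))) ^ n" by (simp only: power_mult_distrib)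
  also have "\<dots> \<le> (17/25) ^ n" by (rule power_mono) auto
  finally show ?thesis .
qed

abbreviation row_null :: "nat \<Rightarrow> (nat \<Rightarrow> nat \<Rightarrow> bool) \<Rightarrow> (nat \<Rightarrow> real) \<Rightarrow> bool" where
  "row_null n b \<equiv> null_vector {..<n} {..<n} (\<lambda>i j. of_bool (b i j))"

lemma null_vector_rows_cong:
  "(\<And>i. i \<in> T \<Longrightarrow> b i = b' i) \<Longrightarrow>
    null_vector T J (\<lambda>i j. of_bool (b i j)) = null_vector T J (\<lambda>i j. of_bool (b' i j))"
  by (auto simp: null_vector_def fun_eq_iff)

lemma littlewood_offord_support:
  fixes p :: real and x :: "nat \<Rightarrow> real"
  assumes p: "0 < p" "p \<le> 1/2" and c: "0 < c" "c \<le> card (support {..<n} x) * p / 2"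
  shows "measure_pmf.prob (bits {..<n} p) {r. (\<Sum>j<n. of_bool (r j) * x j) = 0} \<le> 3 / sqrt c"
proof -
  have "support {..<n} x \<noteq> {}" using c by auto
  then have "measure_pmf.prob (bits {..<n} p) {r. (\<Sum>j<n. of_bool (r j) * x j) = 0}
      \<le> 3 / sqrt (card (support {..<n} x) * p / 2)"
    unfolding support_def by (intro littlewood_offord p finite_lessThan) auto
  also have "\<dots> \<le> 3 / sqrt c"
    using c by (intro divide_left_mono) auto
  finally show ?thesis .
qed

text \<open>For supports of this size the Littlewood-Offord bound is at most \<open>1/2\<close>; this is where
\<open>72 = 2 * 6\<^sup>2\<close> comes from. A null vector with support \<open>S\<close> is determined, as far as the
remaining rows are concerned, by fewer than \<open>card S\<close> rows \<open>T\<close>: any vector with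
support \<open>S\<close> that is orthogonal to the rows in \<open>T\<close> is orthogonal to all rows. So take one that depends on
these rows only, and sum over \<open>S\<close> and \<open>T\<close>.\<close>

lemma prob_medium_null_vector_le:
  fixes p :: real
  assumes p: "0 < p" "p \<le> 1/2"
  shows "measure_pmf.prob (rand_mat n p)
    {b. \<exists>x. row_null n b x \<and> 72 < card (support {..<n} x) * p \<and> 36 * card (support {..<n} x) \<le> n}
      \<le> n * (17/25) ^ n"
proof -
  define I where "I = {k. 0 < k \<and> 36 * k \<le> n \<and> 72 < k * p}"
  define sets where "sets k = {S. S \<subseteq> {..<n} \<and> card S = k}" for k
  have fin: "finite I" "finite (sets k)" for k
  proof -
    show "finite I" by (rule finite_subset[of _ "{..n}"]) (auto simp: I_def)
    show "finite (sets k)" by (rule finite_subset[of _ "Pow {..<n}"]) (auto simp: sets_def)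
  qed
  have card_sets: "card (sets k) = n choose k" for k
    using n_subsets[of "{..<n}" k] by (simp add: sets_def)
  define X where "X S T b = (SOME x. support {..<n} x = S \<and> null_vector T {..<n} (\<lambda>i j. of_bool (b i j)) x)"
    for S T :: "nat set" and b
  define F where "F S T = {b. support {..<n} (X S T b) = S \<and>
      (\<forall>i\<in>{..<n} - T. (\<Sum>j<n. of_bool (b i j) * X S T b j) = 0)}" for S T
  let ?E = "{b. \<exists>x. row_null n b x \<and> 72 < card (support {..<n} x) * p \<and> 36 * card (support {..<n} x) \<le> n}"
  have "measure_pmf.prob (rand_mat n p) ?E \<le> (\<Sum>k\<in>I. (17/25) ^ n)"
  proof (rule prob_union_bound[OF fin(1)])
    show "?E \<subseteq> (\<Union>k\<in>I. \<Union>S\<in>sets k. \<Union>T\<in>sets (k - 1). F S T)"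
    proof
      fix b assume "b \<in> ?E"
      then obtain x where x: "row_null n b x" "72 < card (support {..<n} x) * p"
        "36 * card (support {..<n} x) \<le> n" by auto
      define S where "S = support {..<n} x"
      have ne: "S \<noteq> {}" using x(2) by (auto simp: S_def)
      have S: "S \<subseteq> {..<n}" "finite S" by (auto simp: S_def support_def)
      then have cardS: "0 < card S" using ne by (simp add: card_gt_0_iff)
      have kI: "card S \<in> I" using x cardS by (simp add: I_def S_def)
      from determining_rows[OF x(1) _ _ ne[unfolded S_def]] obtain T0 where T0: "T0 \<subseteq> {..<n}"
        "card T0 < card S" and det: "\<And>z. support {..<n} z \<subseteq> S \<Longrightarrow>
          null_vector T0 {..<n} (\<lambda>i j. of_bool (b i j)) z \<Longrightarrow> row_null n b z"
        by (auto simp: S_def)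
      have "card T0 \<le> card S - 1" "card S - 1 \<le> card {..<n}"
        using T0(2) card_mono[OF finite_lessThan S(1)] by auto
      from exists_subset_between[OF this T0(1)] obtain T
        where T: "T0 \<subseteq> T" "T \<subseteq> {..<n}" "card T = card S - 1" by auto
      have "support {..<n} (X S T b) = S \<and> null_vector T {..<n} (\<lambda>i j. of_bool (b i j)) (X S T b)"
        unfolding X_def
        by (rule someI[of _ x]) (use x(1) T(2) in \<open>auto simp: S_def null_vector_def\<close>)
      then have XS: "support {..<n} (X S T b) = S"
        and "null_vector T {..<n} (\<lambda>i j. of_bool (b i j)) (X S T b)" by auto
      then have "null_vector T0 {..<n} (\<lambda>i j. of_bool (b i j)) (X S T b)"
        using T(1) by (auto simp: null_vector_def)
      from det[OF _ this] have "row_null n b (X S T b)" using XS by simp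
      with XS have "b \<in> F S T" by (simp add: F_def null_vector_def)
      moreover have "S \<in> sets (card S)" "T \<in> sets (card S - 1)" using S T by (auto simp: sets_def)
      ultimately show "b \<in> (\<Union>k\<in>I. \<Union>S\<in>sets k. \<Union>T\<in>sets (k - 1). F S T)" using kI by blast
    qed
    fix k assume k: "k \<in> I"
    have "measure_pmf.prob (rand_mat n p) (\<Union>S\<in>sets k. \<Union>T\<in>sets (k - 1). F S T)
        \<le> (\<Sum>S\<in>sets k. \<Sum>T\<in>sets (k - 1). (1/2) ^ (n - (k - 1)))"
    proof (intro prob_union_bound[OF fin(2) order_refl])
      fix S T assume S: "S \<in> sets k" and T: "T \<in> sets (k - 1)"
      have "measure_pmf.prob (rand_mat n p) (F S T) \<le> (1/2) ^ (n - card T)"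
        unfolding F_def
      proof (rule prob_rows_orthogonal[where P = "\<lambda>x. support {..<n} x = S"])
        show "T \<subseteq> {..<n}" using T by (simp add: sets_def)
        show "X S T b = X S T b'" if "\<And>i. i \<in> T \<Longrightarrow> b i = b' i" for b b'
          unfolding X_def using null_vector_rows_cong[of T b b'] that by simp
        fix x assume "support {..<n} x = S"
        then have "36 \<le> card (support {..<n} x) * p / 2" using k S by (simp add: I_def sets_def)
        from littlewood_offord_support[OF p _ this]
        show "measure_pmf.prob (bits {..<n} p) {r. (\<Sum>j<n. of_bool (r j) * x j) = 0} \<le> 1/2"
          by (simp add: real_sqrt_unique[of 6])
      qed simp
      then show "measure_pmf.prob (rand_mat n p) (F S T) \<le> (1/2) ^ (n - (k - 1))"
        using T by (simp add: sets_def)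
    qed
    also have "\<dots> = real (n choose k) * (real (n choose (k - 1)) * (1/2) ^ (n - (k - 1)))"
      by (simp add: card_sets)
    also have "\<dots> \<le> (17/25) ^ n" using k by (intro medium_term_le) (auto simp: I_def)
    finally show "measure_pmf.prob (rand_mat n p) (\<Union>S\<in>sets k. \<Union>T\<in>sets (k - 1). F S T)
        \<le> (17/25) ^ n" .
  qed
  also have "\<dots> = card I * (17/25) ^ n" by simp
  also have "\<dots> \<le> n * (17/25) ^ n"
  proof (rule mult_right_mono)
    have "I \<subseteq> {1..n}" by (auto simp: I_def)
    then show "real (card I) \<le> real n" using card_mono[of "{1..n}" I] by simp
  qed simp
  finally show ?thesis .
qed

section \<open>Left and right null vectors of large support\<close>

abbreviation col_null :: "nat \<Rightarrow> (nat \<Rightarrow> nat \<Rightarrow> bool) \<Rightarrow> (nat \<Rightarrow> real) \<Rightarrow> bool" where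
  "col_null n b \<equiv> null_vector {..<n} {..<n} (\<lambda>j i. of_bool (b i j))"

text \<open>If \<open>y\<close> is a left null vector with \<open>y i \<noteq> 0\<close>, then row \<open>i\<close> is a combination of the other rows, so
it is orthogonal to every right null vector of the other rows. Choose such a vector with large
support from the other rows alone; row \<open>i\<close> is independent of it. This bounds the probability of
\<open>F i\<close> by \<open>q\<close>. When both null vectors have large support, at least \<open>n / 36\<close> of the events \<open>F i\<close>
occur together, so no union bound over supports is paid.\<close>

lemma prob_large_null_vectors_le:
  fixes p :: real
  assumes p: "0 < p" "p \<le> 1/2" and n: "0 < n"
  shows "measure_pmf.prob (rand_mat n p)
    {b. (\<exists>x. row_null n b x \<and> n < 36 * card (support {..<n} x)) \<and>
        (\<exists>y. col_null n b y \<and> n < 36 * card (support {..<n} y))} \<le> 108 / sqrt (n * p / 72)"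
proof -
  let ?Pr = "measure_pmf.prob (rand_mat n p)"
  define q where "q = 3 / sqrt (n * p / 72)"
  define E where "E = {b. (\<exists>x. row_null n b x \<and> n < 36 * card (support {..<n} x)) \<and>
        (\<exists>y. col_null n b y \<and> n < 36 * card (support {..<n} y))}"
  define F where "F i = {b. (\<exists>x. row_null n b x \<and> n < 36 * card (support {..<n} x)) \<and>
        (\<exists>y. col_null n b y \<and> y i \<noteq> 0)}" for i
  have F: "?Pr (F i) \<le> q" if i: "i < n" for i
  proof -
    define T where "T = {..<n} - {i}"
    define X where "X b = (SOME x. n < 36 * card (support {..<n} x) \<and>
        null_vector T {..<n} (\<lambda>i j. of_bool (b i j)) x)" for b
    have "F i \<subseteq> {b. n < 36 * card (support {..<n} (X b)) \<and>
        (\<forall>i\<in>{..<n} - T. (\<Sum>j<n. of_bool (b i j) * X b j) = (0::real))}"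
    proof
      fix b assume "b \<in> F i"
      then obtain x y where x: "row_null n b x" "n < 36 * card (support {..<n} x)"
        and y: "col_null n b y" "y i \<noteq> 0" by (auto simp: F_def)
      have X: "n < 36 * card (support {..<n} (X b)) \<and>
          null_vector T {..<n} (\<lambda>i j. of_bool (b i j)) (X b)"
        unfolding X_def
        by (rule someI[of _ x]) (use x in \<open>auto simp: T_def null_vector_def\<close>)
      have "0 = (\<Sum>j<n. X b j * (\<Sum>k<n. of_bool (b k j) * y k))"
        using y(1) by (simp add: null_vector_def)
      also have "\<dots> = (\<Sum>k<n. y k * (\<Sum>j<n. of_bool (b k j) * X b j))"
        unfolding sum_distrib_left by (subst sum.swap) (simp add: mult_ac)
      also have "\<dots> = y i * (\<Sum>j<n. of_bool (b i j) * X b j)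
          + (\<Sum>k\<in>T. y k * (\<Sum>j<n. of_bool (b k j) * X b j))"
        unfolding T_def using i by (subst sum.remove[of _ i]) auto
      also have "(\<Sum>k\<in>T. y k * (\<Sum>j<n. of_bool (b k j) * X b j)) = 0"
        using X by (intro sum.neutral ballI) (simp only: null_vector_def mult_zero_right)
      finally have "(\<Sum>j<n. of_bool (b i j) * X b j) = 0" using y(2) by simp
      moreover have "{..<n} - T = {i}" using i by (auto simp: T_def)
      ultimately show "b \<in> {b. n < 36 * card (support {..<n} (X b)) \<and>
          (\<forall>i\<in>{..<n} - T. (\<Sum>j<n. of_bool (b i j) * X b j) = (0::real))}" using X by simp
    qed
    then have "?Pr (F i) \<le> ?Pr {b. n < 36 * card (support {..<n} (X b)) \<and>
        (\<forall>i\<in>{..<n} - T. (\<Sum>j<n. of_bool (b i j) * X b j) = (0::real))}"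
      by (intro measure_pmf.finite_measure_mono) auto
    also have "\<dots> \<le> q ^ (n - card T)"
    proof (rule prob_rows_orthogonal)
      show "T \<subseteq> {..<n}" by (auto simp: T_def)
      show "X b = X b'" if "\<And>i. i \<in> T \<Longrightarrow> b i = b' i" for b b'
        unfolding X_def using null_vector_rows_cong[of T b b'] that by simp
      fix x assume "n < 36 * card (support {..<n} x)"
      then have "real n \<le> 36 * real (card (support {..<n} x))" by linarith
      then have "real n * p \<le> 36 * real (card (support {..<n} x)) * p" using p by (intro mult_right_mono) auto
      then have "n * p / 72 \<le> card (support {..<n} x) * p / 2" by (simp add: mult_ac)
      from littlewood_offord_support[OF p _ this] n p
      show "measure_pmf.prob (bits {..<n} p) {r. (\<Sum>j<n. of_bool (r j) * x j) = 0} \<le> q"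
        by (simp add: q_def)
    qed (use p in \<open>simp add: q_def\<close>)
    also have "n - card T = 1" using i by (simp add: T_def)
    finally show ?thesis by simp
  qed
  have int: "integrable (measure_pmf (rand_mat n p)) (indicator A :: _ \<Rightarrow> real)" for A
    by (rule measure_pmf.integrable_const_bound[of _ 1]) (auto simp: indicator_def)
  have "real n / 36 * ?Pr E = measure_pmf.expectation (rand_mat n p) (\<lambda>b. real n / 36 * indicator E b)"
    using int by simp
  also have "\<dots> \<le> measure_pmf.expectation (rand_mat n p) (\<lambda>b. \<Sum>i<n. indicator (F i) b)"
  proof (rule integral_mono)
    fix b
    show "real n / 36 * indicator E b \<le> (\<Sum>i<n. indicator (F i) b)"
    proof (cases "b \<in> E")
      case True
      then obtain x y where x: "row_null n b x" "n < 36 * card (support {..<n} x)"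
        and y: "col_null n b y" "n < 36 * card (support {..<n} y)" by (auto simp: E_def)
      have "real n / 36 \<le> real (card (support {..<n} y))" using y(2) by simp
      also have "\<dots> = (\<Sum>i\<in>support {..<n} y. indicator (F i) b)"
      proof -
        have "b \<in> F i" if "i \<in> support {..<n} y" for i
          using that x y(1) unfolding F_def support_def by blast
        then show ?thesis by simp
      qed
      also have "\<dots> \<le> (\<Sum>i<n. indicator (F i) b)"
        by (rule sum_mono2) (auto simp: support_def)
      finally show ?thesis using True by simp
    qed (simp add: sum_nonneg)
  qed (use int in auto)
  also have "\<dots> = (\<Sum>i<n. ?Pr (F i))" using int by simp
  also have "\<dots> \<le> (\<Sum>i<n. q)" using F by (intro sum_mono) auto
  finally have "real n / 36 * ?Pr E \<le> real n * q" by simp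
  then have "?Pr E \<le> 36 * q" using n by simp
  then show ?thesis by (simp add: E_def q_def)
qed

section \<open>The exceptional event is unlikely\<close>

text \<open>By \<open>both_null_spaces_of_core_nontrivial\<close> this contains every matrix for which some run ends in a core with
null vectors on both sides. Unlike that property it does not mention runs.\<close>

definition exceptional :: "nat \<Rightarrow> (nat \<Rightarrow> nat \<Rightarrow> bool) set" where
  "exceptional n = {b.
     (\<exists>x. row_null n b x \<and> support {..<n} x \<noteq> {} \<and> surplus n b (support {..<n} x)) \<and>
     (\<exists>y. col_null n b y \<and> support {..<n} y \<noteq> {} \<and> surplus n (\<lambda>j i. b i j) (support {..<n} y))}"

lemma prob_rand_mat_transpose:
  "measure_pmf.prob (rand_mat n p) {b. (\<lambda>j i. b i j) \<in> E} = measure_pmf.prob (rand_mat n p) E"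
proof -
  have "measure_pmf.prob (rand_mat n p) E = measure_pmf.prob (map_pmf (\<lambda>b j i. b i j) (rand_mat n p)) E"
    by (simp add: rand_mat_transpose)
  also have "\<dots> = measure_pmf.prob (rand_mat n p) {b. (\<lambda>j i. b i j) \<in> E}"
    by (simp add: vimage_def)
  finally show ?thesis by simp
qed

text \<open>The three ranges of support sizes, the first two for columns and for rows.\<close>

lemma prob_exceptional_le:
  fixes p :: real
  assumes p: "0 < p" "p \<le> 1/2" and n: "144 \<le> n * p" and rate: "sparse_rate (n * p) \<le> 1/2"
  shows "measure_pmf.prob (rand_mat n p) (exceptional n)
    \<le> 2 * (4 * sparse_rate (n * p) + n * (17/25) ^ n) + 108 / sqrt (n * p / 72)"
proof -
  let ?Pr = "measure_pmf.prob (rand_mat n p)"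
  define A where "A = {b. \<exists>S\<subseteq>{..<n}. S \<noteq> {} \<and> card S * p \<le> 72 \<and> surplus n b S}"
  define B where "B = {b. \<exists>x. row_null n b x \<and> 72 < card (support {..<n} x) * p \<and> 36 * card (support {..<n} x) \<le> n}"
  define C where "C = {b. (\<exists>x. row_null n b x \<and> n < 36 * card (support {..<n} x)) \<and>
        (\<exists>y. col_null n b y \<and> n < 36 * card (support {..<n} y))}"
  define AT where "AT = {b. (\<lambda>j i. b i j) \<in> A}"
  define BT where "BT = {b. (\<lambda>j i. b i j) \<in> B}"
  have n0: "0 < n" using n by (cases n) auto
  have A: "?Pr A \<le> 4 * sparse_rate (n * p)"
    unfolding A_def by (rule prob_sparse_surplus_le[OF p n rate])
  have B: "?Pr B \<le> n * (17/25) ^ n"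
    unfolding B_def by (rule prob_medium_null_vector_le[OF p])
  have C: "?Pr C \<le> 108 / sqrt (n * p / 72)"
    unfolding C_def by (rule prob_large_null_vectors_le[OF p n0])
  have cases: "b \<in> A \<or> b \<in> B \<or> n < 36 * card (support {..<n} x)"
    if "row_null n b x" "support {..<n} x \<noteq> {}" "surplus n b (support {..<n} x)" for b x
  proof (cases "card (support {..<n} x) * p \<le> 72")
    case True
    moreover have "support {..<n} x \<subseteq> {..<n}" by (auto simp: support_def)
    ultimately show ?thesis using that by (auto simp: A_def)
  next
    case False
    then show ?thesis using that by (auto simp: B_def not_le)
  qed
  have "exceptional n \<subseteq> (A \<union> B) \<union> (AT \<union> BT) \<union> C"
  proof
    fix b assume "b \<in> exceptional n"
    then obtain x y where x: "row_null n b x" "support {..<n} x \<noteq> {}" "surplus n b (support {..<n} x)"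
      and y: "col_null n b y" "support {..<n} y \<noteq> {}" "surplus n (\<lambda>j i. b i j) (support {..<n} y)"
      by (auto simp: exceptional_def)
    from cases[OF x] cases[of "\<lambda>j i. b i j", OF y] show "b \<in> (A \<union> B) \<union> (AT \<union> BT) \<union> C"
      using x(1) y(1) by (auto simp: AT_def BT_def C_def)
  qed
  then have "?Pr (exceptional n) \<le> ?Pr ((A \<union> B) \<union> (AT \<union> BT) \<union> C)"
    by (intro measure_pmf.finite_measure_mono) auto
  also have "\<dots> \<le> (?Pr A + ?Pr B) + (?Pr AT + ?Pr BT) + ?Pr C"
    by (intro order.trans[OF measure_Un_le] add_mono order_refl) auto
  also have "\<dots> \<le> 2 * (4 * sparse_rate (n * p) + n * (17/25) ^ n) + 108 / sqrt (n * p / 72)"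
    using A B C by (simp add: AT_def BT_def prob_rand_mat_transpose)
  finally show ?thesis .
qed

lemma bernoulli_mat_eq_rand_mat: "bernoulli_mat n p = map_pmf (bool_mat n) (rand_mat n p)"
  unfolding bernoulli_mat_def bits_pairs_eq_rand_mat map_pmf_comp
  by (intro map_pmf_cong refl eq_matI) (auto simp: bool_mat_def)

lemma not_exceptional_indep_columns:
  assumes "b \<notin> exceptional n" "karp_sipser (bip_graph (bool_mat n b)) G"
  shows "indep_columns (left (core G)) (right (core G)) (\<lambda>i j. of_bool (b i j)) \<or>
      indep_columns (right (core G)) (left (core G)) (\<lambda>j i. of_bool (b i j))"
  using both_null_spaces_of_core_nontrivial[OF assms(2)] assms(1)
  by (auto simp: exceptional_def)

lemma sparse_rate_tendsto_0: "(sparse_rate \<longlongrightarrow> 0) at_top"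
proof -
  define c where "c = exp (- 144) / (2 :: real)"
  have c: "c > 0" by (simp add: c_def)
  have "filterlim (\<lambda>d. c * d) at_top at_top"
    using c filterlim_ident by (intro filterlim_tendsto_pos_mult_at_top[OF tendsto_const])
  from filterlim_compose[OF tendsto_power_div_exp_0[of 2] this]
  have "((\<lambda>d. (2 * exp 2 / c\<^sup>2) * ((c * d)\<^sup>2 / exp (c * d))) \<longlongrightarrow> (2 * exp 2 / c\<^sup>2) * 0) at_top"
    by (intro tendsto_mult tendsto_const)
  moreover have "(2 * exp 2 / c\<^sup>2) * ((c * d)\<^sup>2 / exp (c * d)) = sparse_rate d" for d
    using c unfolding sparse_rate_def c_def[symmetric]
    by (simp add: power_mult_distrib exp_minus field_simps)
  ultimately show ?thesis by simp
qed

lemma prob_exceptional_tendsto_0: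
  fixes p :: "nat \<Rightarrow> real"
  assumes p_bounds: "\<And>n. 0 \<le> p n \<and> p n \<le> 1/2"
    and p_omega: "p \<in> \<omega>(\<lambda>n. 1 / real n)"
  shows "(\<lambda>n. measure_pmf.prob (rand_mat n (p n)) (exceptional n)) \<longlonglongrightarrow> 0"
proof -
  define d where "d n = real n * p n" for n
  have "eventually (\<lambda>n. 1 / real n \<noteq> 0) sequentially"
    using eventually_gt_at_top[of 0] by eventually_elim simp
  from smallomegaD_filterlim_at_top_norm[OF p_omega this]
  have "filterlim (\<lambda>n. norm (p n / (1 / real n))) at_top sequentially" .
  moreover have "norm (p n / (1 / real n)) = d n" for n
    using p_bounds[of n] by (simp add: d_def abs_mult mult.commute)
  ultimately have d: "filterlim d at_top sequentially" by simp
  have rate: "(\<lambda>n. sparse_rate (d n)) \<longlonglongrightarrow> 0"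
    by (rule filterlim_compose[OF sparse_rate_tendsto_0 d])
  have "filterlim (\<lambda>n. sqrt (d n * (1/72))) at_top sequentially"
    by (intro filterlim_compose[OF sqrt_at_top] filterlim_at_top_mult_tendsto_pos[OF tendsto_const _ d]) simp
  then have root: "(\<lambda>n. 108 / sqrt (d n * (1/72))) \<longlonglongrightarrow> 0"
    by (intro tendsto_divide_0[OF tendsto_const] filterlim_at_top_imp_at_infinity)
  have geo: "(\<lambda>n. real n * (17/25) ^ n) \<longlonglongrightarrow> 0"
    by (rule powser_times_n_limit_0) simp
  have "(\<lambda>n. 2 * (4 * sparse_rate (d n) + real n * (17/25) ^ n) + 108 / sqrt (d n * (1/72)))
      \<longlonglongrightarrow> 2 * (4 * 0 + 0) + 0"
    by (intro tendsto_intros rate root geo)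
  then have lim: "(\<lambda>n. 2 * (4 * sparse_rate (d n) + real n * (17/25) ^ n) + 108 / sqrt (d n * (1/72)))
      \<longlonglongrightarrow> 0" by simp
  have "eventually (\<lambda>n. 144 \<le> d n) sequentially" using d by (simp add: filterlim_at_top)
  moreover have "eventually (\<lambda>n. sparse_rate (d n) < 1/2) sequentially"
    using rate by (rule order_tendstoD) simp
  ultimately have "eventually (\<lambda>n. measure_pmf.prob (rand_mat n (p n)) (exceptional n)
      \<le> 2 * (4 * sparse_rate (d n) + real n * (17/25) ^ n) + 108 / sqrt (d n * (1/72))) sequentially"
  proof eventually_elim
    case (elim n)
    then have "p n \<noteq> 0" by (auto simp: d_def)
    then have "0 < p n" using p_bounds[of n] by simp
    from prob_exceptional_le[OF this, of n] elim p_bounds[of n] show ?case by (simp add: d_def)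
  qed
  then show ?thesis
    by (intro tendsto_sandwich[OF _ _ tendsto_const lim]) (auto intro: always_eventually)
qed

lemma prob_bernoulli_mat_tendsto_1:
  fixes p :: "nat \<Rightarrow> real"
  assumes p_bounds: "\<And>n. 0 \<le> p n \<and> p n \<le> 1/2"
    and p_omega: "p \<in> \<omega>(\<lambda>n. 1 / real n)"
    and good: "\<And>n b. b \<notin> exceptional n \<Longrightarrow> bool_mat n b \<in> Q n"
  shows "(\<lambda>n. measure_pmf.prob (bernoulli_mat n (p n)) (Q n)) \<longlonglongrightarrow> 1"
proof (rule tendsto_sandwich[where h = "\<lambda>_. 1"])
  have "(\<lambda>n. 1 - measure_pmf.prob (rand_mat n (p n)) (exceptional n)) \<longlonglongrightarrow> 1 - 0"
    by (intro tendsto_diff tendsto_const prob_exceptional_tendsto_0 p_bounds p_omega)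
  then show "(\<lambda>n. 1 - measure_pmf.prob (rand_mat n (p n)) (exceptional n)) \<longlonglongrightarrow> 1" by simp
  show "eventually (\<lambda>n. 1 - measure_pmf.prob (rand_mat n (p n)) (exceptional n)
      \<le> measure_pmf.prob (bernoulli_mat n (p n)) (Q n)) sequentially"
  proof (intro always_eventually allI)
    fix n
    have "1 - measure_pmf.prob (rand_mat n (p n)) (exceptional n)
        = measure_pmf.prob (rand_mat n (p n)) (- exceptional n)"
      using measure_pmf.prob_compl[of "exceptional n" "rand_mat n (p n)"] by (simp add: Compl_eq_Diff_UNIV)
    also have "\<dots> \<le> measure_pmf.prob (rand_mat n (p n)) (bool_mat n -` Q n)"
      using good by (intro measure_pmf.finite_measure_mono) auto
    finally show "1 - measure_pmf.prob (rand_mat n (p n)) (exceptional n)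
        \<le> measure_pmf.prob (bernoulli_mat n (p n)) (Q n)"
      by (simp add: bernoulli_mat_eq_rand_mat)
  qed
qed (auto intro: always_eventually)

theorem theorem1p3:
  fixes p :: "nat \<Rightarrow> real"
  assumes p_bounds: "\<And>n. 0 \<le> p n \<and> p n \<le> 1/2"
    and p_omega: "p \<in> \<omega>(\<lambda>n. 1 / real n)"
  shows "(\<lambda>n. measure_pmf.prob (bernoulli_mat n (p n))
            {B. \<forall>G. karp_sipser (bip_graph B) G \<longrightarrow>
                  corank (biadj (ks_core G)) = 0 \<or>
                  corank (transpose_mat (biadj (ks_core G))) = 0})
          \<longlonglongrightarrow> 1
       \<and> (\<lambda>n. measure_pmf.prob (bernoulli_mat n (p n))
            {B. \<forall>G. karp_sipser (bip_graph B) G \<longrightarrow>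
                  corank B = max (card (isolated_verts G \<inter> Inl ` {..<n}))
                                 (card (isolated_verts G \<inter> Inr ` {..<n}))})
          \<longlonglongrightarrow> 1"
proof (rule conjI; rule prob_bernoulli_mat_tendsto_1[OF p_bounds p_omega]; intro CollectI allI impI)
  fix n b G
  assume "b \<notin> exceptional n" and ks: "karp_sipser (bip_graph (bool_mat n b)) G"
  then have triv: "indep_columns (left (core G)) (right (core G)) (\<lambda>i j. of_bool (b i j)) \<or>
      indep_columns (right (core G)) (left (core G)) (\<lambda>j i. of_bool (b i j))"
    by (rule not_exceptional_indep_columns)
  show "corank (biadj (ks_core G)) = 0 \<or> corank (transpose_mat (biadj (ks_core G))) = 0"
    by (rule corank_core_eq_0[OF ks triv])
  show "corank (bool_mat n b) =
      max (card (isolated_verts G \<inter> Inl ` {..<n})) (card (isolated_verts G \<inter> Inr ` {..<n}))"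
    by (rule corank_eq_isolated[OF ks triv])
qed

end
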